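(* Let $(E,\omega)$ be an LV-graph and $R$ a domain. Then the map $$\nu:L_R(E,\omega)\longrightarrow\mathbb N_0\cup\{-\infty\},\qquad a\longmapsto\max\{|p|\mid p\in\operatorname{supp}(a)\}$$ (with the convention $\max(\emptyset)=-\infty$) is a local valuation on $L_R(E,\omega)$.
   Context: A weighted graph $(E,\omega)$, $E=(E^0,E^{\mathrm{st}},E^1,s,r,\omega)$, consists of countable sets $E^0$ (vertices), $E^{\mathrm{st}}$ (structured edges), $E^1$ (edges), maps $s,r:E^{\mathrm{st}}\to E^0$ and a weight map $\omega:E^{\mathrm{st}}\to\mathbb N=\{1,2,\dots\}$ such that $E^1=\bigsqcup_{\alpha\in E^{\mathrm{st}}}\{\alpha_1,\dots,\alpha_{\omega(\alpha)}\}$. All weighted graphs are assumed row-finite: $s^{-1}(v)\subseteq E^{\mathrm{st}}$ is finite for every $v\in E^0$. A vertex $v$ is a sink if $s^{-1}(v)=\emptyset$; if $v$ is not a sink, $\omega(v):=\max\{\omega(\alpha)\mid\alpha\in s^{-1}(v)\}$. Rings of coefficients $R$ are unital. Let $(E^1)^*=\{\alpha_i^*\mid\alpha_i\in E^1\}$, $X=E^0\cup E^1\cup(E^1)^*$, and let $R\langle X\rangle$ be the free (non-unital) $R$-ring on $X$: the free left $R$-module on the nonempty words over $X$ with multiplication $(\sum r_xx)(\sum s_yy)=\sum r_xs_y\,xy$. The weighted Leavitt path algebra $L_R(E,\omega)$ is the quotient of $R\langle X\rangle$ by the ideal generated by the relations: (1) $vw=\delta_{vw}v$ for $v,w\in E^0$;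 (2) $s(\alpha)\alpha_i=\alpha_ir(\alpha)=\alpha_i$ and $r(\alpha)\alpha_i^*=\alpha_i^*s(\alpha)=\alpha_i^*$ for $\alpha\in E^{\mathrm{st}}$, $1\le i\le\omega(\alpha)$; (3) $\sum_{\alpha\in s^{-1}(v)}\alpha_i\alpha_j^*=\delta_{ij}v$ for every non-sink $v$ and $1\le i,j\le\omega(v)$; (4) $\sum_{1\le i\le\max\{\omega(\alpha),\omega(\beta)\}}\alpha_i^*\beta_i=\delta_{\alpha\beta}r(\alpha)$ for all $\alpha,\beta\in E^{\mathrm{st}}$; where in (3) and (4) $\alpha_i:=\alpha_i^*:=0$ whenever $i>\omega(\alpha)$. A generalised path is a word $p=x_1\cdots x_n$ with $n\ge1$, $x_i\in E^1\cup(E^1)^*$ and $r(x_i)=s(x_{i+1})$ (length $|p|=n$), or $p=x_1\in E^0$ (length $|p|=0$); here $s(v)=r(v)=v$, $s(\alpha_i)=s(\alpha)$, $r(\alpha_i)=r(\alpha)$, $s(\alpha_i^* )=r(\alpha)$, $r(\alpha_i^* )=s(\alpha)$; $s(p)=s(x_1)$, $r(p)=r(x_n)$. For every non-sink $v$ fix $\alpha^v\in E^{\mathrm{st}}$ with $s(\alpha^v)=v$ and $\omega(\alpha^v)=\omega(v)$. A generalised path is normal if it contains no subword $\alpha^v_i(\alpha^v_j)^*$ ($v$ a non-sink, $1\le i,j\le\omega(\alpha^v)$) and no subword $\alpha_1^*\beta_1$ ($\alpha,\beta\in E^{\mathrm{st}}$). The normal generalised paths form a left $R$-module basis of $L_R(E,\omega)$;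 the normal form $\operatorname{NF}(a)$ of $a\in L_R(E,\omega)$ is its unique representative in $R\langle X\rangle$ that is a linear combination of normal generalised paths, and $\operatorname{supp}(a)$ is the set of normal generalised paths occurring in $\operatorname{NF}(a)$ with nonzero coefficient. A local valuation on $L_R(E,\omega)$ is a map $\nu:L_R(E,\omega)\to\mathbb N_0\cup\{-\infty\}$ such that: (i) $\nu(a)=-\infty$ iff $a=0$; (ii) $\nu(a)=0$ iff $a\ne0$ and $\operatorname{supp}(a)\subseteq E^0$; (iii) $\nu(a+b)\le\max\{\nu(a),\nu(b)\}$ for all $a,b$; (iv) $\nu(ab)=\nu(a)+\nu(b)$ for all $v\in E^0$, $a\in L_R(E,\omega)v$, $b\in vL_R(E,\omega)$; with $-\infty\le x$ and $x+(-\infty)=(-\infty)+x=-\infty$ for all $x$. An LV-graph is a weighted graph such that $\omega(\alpha)\ge2$ for all $\alpha\in E^{\mathrm{st}}$; $|\{\alpha\in s^{-1}(v)\mid\omega(\alpha)=\omega(v)\}|\ge2$ for every non-sink $v\in E^0$; $E^{\mathrm{st}}\ne\emptyset$; and $(E,\omega)$ is connected, i.e. for any $u,v\in E^0$ there is a generalised path $p$ with $s(p)=u$, $r(p)=v$. *)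

theory Defs
  imports
    "HOL-Library.Poly_Mapping"
    "HOL-Library.Extended"
    "HOL-Library.Countable_Set"
    "HOL-Library.Sublist"
begin

section \<open>Weighted graphs\<close>

text \<open>
  An edge \<open>\<alpha>\<^sub>i\<close> is represented by the pair of a structured edge \<open>\<alpha>\<close> and an index \<open>i\<close>
  with \<open>1 \<le> i \<le> \<omega>(\<alpha>)\<close>, so the set of edges is a disjoint union by construction.
\<close>

record ('v, 'e) wgraph =
  verts :: "'v set"
  sedges :: "'e set"
  src :: "'e \<Rightarrow> 'v"
  tgt :: "'e \<Rightarrow> 'v"
  weight :: "'e \<Rightarrow> nat"

definition out_sedges :: "('v, 'e) wgraph \<Rightarrow> 'v \<Rightarrow> 'e set" where
  "out_sedges G v = {\<alpha> \<in> sedges G. src G \<alpha> = v}"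

locale weighted_graph =
  fixes G :: "('v, 'e) wgraph"
  assumes countable_verts: "countable (verts G)"
    and countable_sedges: "countable (sedges G)"
    and src_in_verts: "\<And>\<alpha>. \<alpha> \<in> sedges G \<Longrightarrow> src G \<alpha> \<in> verts G"
    and tgt_in_verts: "\<And>\<alpha>. \<alpha> \<in> sedges G \<Longrightarrow> tgt G \<alpha> \<in> verts G"
    and weight_pos: "\<And>\<alpha>. \<alpha> \<in> sedges G \<Longrightarrow> 1 \<le> weight G \<alpha>"
    and row_finite: "\<And>v. v \<in> verts G \<Longrightarrow> finite (out_sedges G v)"

definition sink :: "('v, 'e) wgraph \<Rightarrow> 'v \<Rightarrow> bool" where
  "sink G v \<longleftrightarrow> out_sedges G v = {}"

text \<open>Only meaningful if \<open>v\<close> is not a sink.\<close>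

definition vweight :: "('v, 'e) wgraph \<Rightarrow> 'v \<Rightarrow> nat" where
  "vweight G v = Max (weight G ` out_sedges G v)"

text \<open>The letters \<open>Vert v\<close>, \<open>Edge \<alpha> i\<close>, \<open>Ghost \<alpha> i\<close> stand for \<open>v\<close>, \<open>\<alpha>\<^sub>i\<close>, \<open>\<alpha>\<^sub>i\<^sup>*\<close>.\<close>

datatype ('v, 'e) letter = Vert 'v | Edge 'e nat | Ghost 'e nat

definition edge_letters :: "('v, 'e) wgraph \<Rightarrow> ('v, 'e) letter set" where
  "edge_letters G = {Edge \<alpha> i | \<alpha> i. \<alpha> \<in> sedges G \<and> i \<in> {1..weight G \<alpha>}}
                  \<union> {Ghost \<alpha> i | \<alpha> i. \<alpha> \<in> sedges G \<and> i \<in> {1..weight G \<alpha>}}"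

definition alphabet :: "('v, 'e) wgraph \<Rightarrow> ('v, 'e) letter set" where
  "alphabet G = Vert ` verts G \<union> edge_letters G"

fun letter_src :: "('v, 'e) wgraph \<Rightarrow> ('v, 'e) letter \<Rightarrow> 'v" where
  "letter_src G (Vert v) = v"
| "letter_src G (Edge \<alpha> i) = src G \<alpha>"
| "letter_src G (Ghost \<alpha> i) = tgt G \<alpha>"

fun letter_tgt :: "('v, 'e) wgraph \<Rightarrow> ('v, 'e) letter \<Rightarrow> 'v" where
  "letter_tgt G (Vert v) = v"
| "letter_tgt G (Edge \<alpha> i) = tgt G \<alpha>"
| "letter_tgt G (Ghost \<alpha> i) = src G \<alpha>"

definition gen_path :: "('v, 'e) wgraph \<Rightarrow> ('v, 'e) letter list \<Rightarrow> bool" where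
  "gen_path G p \<longleftrightarrow>
     (\<exists>v \<in> verts G. p = [Vert v]) \<or>
     (p \<noteq> [] \<and> set p \<subseteq> edge_letters G \<and>
      successively (\<lambda>x y. letter_tgt G x = letter_src G y) p)"

definition path_src :: "('v, 'e) wgraph \<Rightarrow> ('v, 'e) letter list \<Rightarrow> 'v" where
  "path_src G p = letter_src G (hd p)"

definition path_tgt :: "('v, 'e) wgraph \<Rightarrow> ('v, 'e) letter list \<Rightarrow> 'v" where
  "path_tgt G p = letter_tgt G (last p)"

fun path_length :: "('v, 'e) letter list \<Rightarrow> nat" where
  "path_length [Vert v] = 0"
| "path_length p = length p"

locale LV_graph = weighted_graph G for G :: "('v, 'e) wgraph" +
  assumes weight_ge_2: "\<And>\<alpha>. \<alpha> \<in> sedges G \<Longrightarrow> 2 \<le> weight G \<alpha>"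
    and two_maximal: "\<And>v. v \<in> verts G \<Longrightarrow> \<not> sink G v \<Longrightarrow>
          2 \<le> card {\<alpha> \<in> out_sedges G v. weight G \<alpha> = vweight G v}"
    and sedges_nonempty: "sedges G \<noteq> {}"
    and connected: "\<And>u v. u \<in> verts G \<Longrightarrow> v \<in> verts G \<Longrightarrow>
          \<exists>p. gen_path G p \<and> path_src G p = u \<and> path_tgt G p = v"


section \<open>Normal generalised paths\<close>

text \<open>A choice \<open>v \<mapsto> \<alpha>\<^sup>v\<close>; its values at sinks are irrelevant.\<close>

definition special_choice :: "('v, 'e) wgraph \<Rightarrow> ('v \<Rightarrow> 'e) \<Rightarrow> bool" where
  "special_choice G sp \<longleftrightarrow>
     (\<forall>v \<in> verts G. \<not> sink G v \<longrightarrow>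
        sp v \<in> sedges G \<and> src G (sp v) = v \<and> weight G (sp v) = vweight G v)"

definition normal_path :: "('v, 'e) wgraph \<Rightarrow> ('v \<Rightarrow> 'e) \<Rightarrow> ('v, 'e) letter list \<Rightarrow> bool" where
  "normal_path G sp p \<longleftrightarrow>
     gen_path G p \<and>
     (\<forall>v \<in> verts G. \<not> sink G v \<longrightarrow>
        (\<forall>i \<in> {1..weight G (sp v)}. \<forall>j \<in> {1..weight G (sp v)}.
           \<not> sublist [Edge (sp v) i, Ghost (sp v) j] p)) \<and>
     (\<forall>\<alpha> \<in> sedges G. \<forall>\<beta> \<in> sedges G. \<not> sublist [Ghost \<alpha> 1, Edge \<beta> 1] p)"


section \<open>The free ring\<close>

text \<open>
  The convolution product of \<^typ>\<open>'k \<Rightarrow>\<^sub>0 'r\<close> needs keys forming an additively written monoid;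
  words therefore carry concatenation as \<open>+\<close> and the empty word as \<open>0\<close>. The non-unital free ring
  consists of the elements supported on nonempty words over the alphabet.
\<close>

datatype 'a free_word = Word (letters: "'a list")

instantiation free_word :: (type) monoid_add
begin

definition zero_free_word :: "'a free_word" where
  "0 = Word []"

definition plus_free_word :: "'a free_word \<Rightarrow> 'a free_word \<Rightarrow> 'a free_word" where
  "u + w = Word (letters u @ letters w)"

instance
  by standard (simp_all add: zero_free_word_def plus_free_word_def)

end

type_synonym ('v, 'e, 'r) free_elem = "('v, 'e) letter free_word \<Rightarrow>\<^sub>0 'r"

definition free_ring :: "('v, 'e) wgraph \<Rightarrow> ('v, 'e, 'r::ring_1) free_elem set" where
  "free_ring G =
     {f. \<forall>w \<in> Poly_Mapping.keys f. letters w \<noteq> [] \<and> set (letters w) \<subseteq> alphabet G}"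

text \<open>The left scalar multiplication; \<open>single 0 r\<close> is \<open>r\<close> times the empty word.\<close>

definition scale :: "'r::ring_1 \<Rightarrow> ('v, 'e, 'r) free_elem \<Rightarrow> ('v, 'e, 'r) free_elem" where
  "scale r f = Poly_Mapping.single 0 r * f"

definition vertex_elem :: "'v \<Rightarrow> ('v, 'e, 'r::ring_1) free_elem" where
  "vertex_elem v = Poly_Mapping.single (Word [Vert v]) 1"

text \<open>Out-of-range indices yield \<open>0\<close>.\<close>

definition edge_elem :: "('v, 'e) wgraph \<Rightarrow> 'e \<Rightarrow> nat \<Rightarrow> ('v, 'e, 'r::ring_1) free_elem" where
  "edge_elem G \<alpha> i =
     (if i \<in> {1..weight G \<alpha>} then Poly_Mapping.single (Word [Edge \<alpha> i]) 1 else 0)"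

definition ghost_elem :: "('v, 'e) wgraph \<Rightarrow> 'e \<Rightarrow> nat \<Rightarrow> ('v, 'e, 'r::ring_1) free_elem" where
  "ghost_elem G \<alpha> i =
     (if i \<in> {1..weight G \<alpha>} then Poly_Mapping.single (Word [Ghost \<alpha> i]) 1 else 0)"


section \<open>The weighted Leavitt path algebra\<close>

text \<open>A relation \<open>x = y\<close> is represented by the element \<open>x - y\<close>.\<close>

inductive_set lpa_relations :: "('v, 'e) wgraph \<Rightarrow> ('v, 'e, 'r::ring_1) free_elem set"
  for G :: "('v, 'e) wgraph"
where
  vert: "v \<in> verts G \<Longrightarrow> w \<in> verts G \<Longrightarrow>
    vertex_elem v * vertex_elem w - (if v = w then vertex_elem v else 0) \<in> lpa_relations G"
| edge_src: "\<alpha> \<in> sedges G \<Longrightarrow> i \<in> {1..weight G \<alpha>} \<Longrightarrow>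
    vertex_elem (src G \<alpha>) * edge_elem G \<alpha> i - edge_elem G \<alpha> i \<in> lpa_relations G"
| edge_tgt: "\<alpha> \<in> sedges G \<Longrightarrow> i \<in> {1..weight G \<alpha>} \<Longrightarrow>
    edge_elem G \<alpha> i * vertex_elem (tgt G \<alpha>) - edge_elem G \<alpha> i \<in> lpa_relations G"
| ghost_src: "\<alpha> \<in> sedges G \<Longrightarrow> i \<in> {1..weight G \<alpha>} \<Longrightarrow>
    vertex_elem (tgt G \<alpha>) * ghost_elem G \<alpha> i - ghost_elem G \<alpha> i \<in> lpa_relations G"
| ghost_tgt: "\<alpha> \<in> sedges G \<Longrightarrow> i \<in> {1..weight G \<alpha>} \<Longrightarrow>
    ghost_elem G \<alpha> i * vertex_elem (src G \<alpha>) - ghost_elem G \<alpha> i \<in> lpa_relations G"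
| edge_ghost: "v \<in> verts G \<Longrightarrow> \<not> sink G v \<Longrightarrow>
    i \<in> {1..vweight G v} \<Longrightarrow> j \<in> {1..vweight G v} \<Longrightarrow>
    (\<Sum>\<alpha>\<in>out_sedges G v. edge_elem G \<alpha> i * ghost_elem G \<alpha> j)
      - (if i = j then vertex_elem v else 0) \<in> lpa_relations G"
| ghost_edge: "\<alpha> \<in> sedges G \<Longrightarrow> \<beta> \<in> sedges G \<Longrightarrow>
    (\<Sum>i\<in>{1..max (weight G \<alpha>) (weight G \<beta>)}. ghost_elem G \<alpha> i * edge_elem G \<beta> i)
      - (if \<alpha> = \<beta> then vertex_elem (tgt G \<alpha>) else 0) \<in> lpa_relations G"

text \<open>
  The ideal is that of an \<open>R\<close>-ring: as the free ring has no unit, closure under scalars does not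
  follow from closure under its multiplications and has to be required separately. Closure under
  right scalars does follow, because the relations have central (integer) coefficients.
\<close>

inductive_set lpa_ideal :: "('v, 'e) wgraph \<Rightarrow> ('v, 'e, 'r::ring_1) free_elem set"
  for G :: "('v, 'e) wgraph"
where
  zero: "0 \<in> lpa_ideal G"
| rel: "x \<in> lpa_relations G \<Longrightarrow> x \<in> lpa_ideal G"
| add: "x \<in> lpa_ideal G \<Longrightarrow> y \<in> lpa_ideal G \<Longrightarrow> x + y \<in> lpa_ideal G"
| scale: "x \<in> lpa_ideal G \<Longrightarrow> scale r x \<in> lpa_ideal G"
| left: "f \<in> free_ring G \<Longrightarrow> x \<in> lpa_ideal G \<Longrightarrow> f * x \<in> lpa_ideal G"
| right: "x \<in> lpa_ideal G \<Longrightarrow> f \<in> free_ring G \<Longrightarrow> x * f \<in> lpa_ideal G"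

text \<open>Elements of the algebra are cosets of the ideal in the free ring.\<close>

type_synonym ('v, 'e, 'r) lpa_elem = "('v, 'e, 'r) free_elem set"

definition lpa_class :: "('v, 'e) wgraph \<Rightarrow> ('v, 'e, 'r::ring_1) free_elem \<Rightarrow> ('v, 'e, 'r) lpa_elem" where
  "lpa_class G f = {g \<in> free_ring G. g - f \<in> lpa_ideal G}"

definition lpa :: "('v, 'e) wgraph \<Rightarrow> ('v, 'e, 'r::ring_1) lpa_elem set" where
  "lpa G = lpa_class G ` free_ring G"

definition lpa_zero :: "('v, 'e) wgraph \<Rightarrow> ('v, 'e, 'r::ring_1) lpa_elem" where
  "lpa_zero G = lpa_class G 0"

definition lpa_add ::
    "('v, 'e) wgraph \<Rightarrow> ('v, 'e, 'r::ring_1) lpa_elem \<Rightarrow> ('v, 'e, 'r) lpa_elem \<Rightarrow> ('v, 'e, 'r) lpa_elem" where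
  "lpa_add G a b = (\<Union>f\<in>a. \<Union>g\<in>b. lpa_class G (f + g))"

definition lpa_mult ::
    "('v, 'e) wgraph \<Rightarrow> ('v, 'e, 'r::ring_1) lpa_elem \<Rightarrow> ('v, 'e, 'r) lpa_elem \<Rightarrow> ('v, 'e, 'r) lpa_elem" where
  "lpa_mult G a b = (\<Union>f\<in>a. \<Union>g\<in>b. lpa_class G (f * g))"

definition lpa_vertex :: "('v, 'e) wgraph \<Rightarrow> 'v \<Rightarrow> ('v, 'e, 'r::ring_1) lpa_elem" where
  "lpa_vertex G v = lpa_class G (vertex_elem v)"


section \<open>Well-definedness of the quotient operations\<close>

lemma diff_add_diff_swap: "(a - b) + (c - d) = (a + c) - (b + d)"
  for a b c d :: "'a::ab_group_add"
  by (simp add: algebra_simps)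

lemma mult_diff_swap: "a * (b - c) + (a - d) * c = a * b - d * c"
  for a b c d :: "'a::ring"
  by (simp add: algebra_simps)

lemma scale_minus_one: "scale (- 1) f = - f"
  by (simp add: scale_def single_uminus)

lemma lpa_ideal_uminus: "x \<in> lpa_ideal G \<Longrightarrow> - x \<in> lpa_ideal G"
  using lpa_ideal.scale[of x G "- 1"] by (simp add: scale_minus_one)

lemma lpa_ideal_diff: "x \<in> lpa_ideal G \<Longrightarrow> y \<in> lpa_ideal G \<Longrightarrow> x - y \<in> lpa_ideal G"
  using lpa_ideal.add[OF _ lpa_ideal_uminus, of x G y] by simp

lemma lpa_class_self: "f \<in> free_ring G \<Longrightarrow> f \<in> lpa_class G f"
  by (simp add: lpa_class_def lpa_ideal.zero)

lemma lpa_class_cong: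
  assumes "f - g \<in> lpa_ideal G"
  shows "lpa_class G f = lpa_class G g"
proof -
  have "h - f \<in> lpa_ideal G \<longleftrightarrow> h - g \<in> lpa_ideal G" for h
  proof
    assume "h - f \<in> lpa_ideal G"
    from lpa_ideal.add[OF this assms] show "h - g \<in> lpa_ideal G" by (simp only: diff_add_eq_diff_diff_swap diff_add_cancel add_diff_eq)
  next
    assume "h - g \<in> lpa_ideal G"
    from lpa_ideal_diff[OF this assms] show "h - f \<in> lpa_ideal G" by (simp only: diff_diff_eq2 diff_add_cancel)
  qed
  then show ?thesis unfolding lpa_class_def by blast
qed

lemma lpa_class_eq_iff:
  assumes "f \<in> free_ring G"
  shows "lpa_class G f = lpa_class G g \<longleftrightarrow> f - g \<in> lpa_ideal G"
proof
  assume "lpa_class G f = lpa_class G g"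
  with lpa_class_self[OF assms] have "f \<in> lpa_class G g" by blast
  then show "f - g \<in> lpa_ideal G" unfolding lpa_class_def by blast
qed (rule lpa_class_cong)

lemma lpa_add_class:
  assumes "f \<in> free_ring G" and "g \<in> free_ring G"
  shows "lpa_add G (lpa_class G f) (lpa_class G g) = lpa_class G (f + g)"
proof -
  have "lpa_class G (f' + g') = lpa_class G (f + g)"
    if "f' \<in> lpa_class G f" "g' \<in> lpa_class G g" for f' g'
  proof (rule lpa_class_cong)
    have "(f' - f) + (g' - g) \<in> lpa_ideal G"
      using that unfolding lpa_class_def by (blast intro: lpa_ideal.add)
    also have "(f' - f) + (g' - g) = (f' + g') - (f + g)"
      by (rule diff_add_diff_swap)
    finally show "(f' + g') - (f + g) \<in> lpa_ideal G" .
  qed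
  then show ?thesis
    unfolding lpa_add_def using lpa_class_self[OF assms(1)] lpa_class_self[OF assms(2)] by blast
qed

lemma lpa_mult_class:
  assumes "f \<in> free_ring G" and "g \<in> free_ring G"
  shows "lpa_mult G (lpa_class G f) (lpa_class G g) = lpa_class G (f * g)"
proof -
  have "lpa_class G (f' * g') = lpa_class G (f * g)"
    if f': "f' \<in> lpa_class G f" and g': "g' \<in> lpa_class G g" for f' g'
  proof (rule lpa_class_cong)
    have "f' * (g' - g) \<in> lpa_ideal G"
      using f' g' unfolding lpa_class_def by (blast intro: lpa_ideal.left)
    moreover have "(f' - f) * g \<in> lpa_ideal G"
      using f' assms(2) unfolding lpa_class_def by (blast intro: lpa_ideal.right)
    ultimately have "f' * (g' - g) + (f' - f) * g \<in> lpa_ideal G"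
      by (rule lpa_ideal.add)
    also have "f' * (g' - g) + (f' - f) * g = f' * g' - f * g"
      by (rule mult_diff_swap)
    finally show "f' * g' - f * g \<in> lpa_ideal G" .
  qed
  then show ?thesis
    unfolding lpa_mult_def using lpa_class_self[OF assms(1)] lpa_class_self[OF assms(2)] by blast
qed


section \<open>Normal forms and local valuations\<close>

definition NF ::
    "('v, 'e) wgraph \<Rightarrow> ('v \<Rightarrow> 'e) \<Rightarrow> ('v, 'e, 'r::ring_1) lpa_elem \<Rightarrow> ('v, 'e, 'r) free_elem" where
  "NF G sp a = (THE f. f \<in> a \<and> (\<forall>w \<in> Poly_Mapping.keys f. normal_path G sp (letters w)))"

definition supp ::
    "('v, 'e) wgraph \<Rightarrow> ('v \<Rightarrow> 'e) \<Rightarrow> ('v, 'e, 'r::ring_1) lpa_elem \<Rightarrow> ('v, 'e) letter list set" where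
  "supp G sp a = letters ` Poly_Mapping.keys (NF G sp a)"

text \<open>
  The set \<open>\<nat>\<^sub>0 \<union> {-\<infinity>}\<close> is the part of \<^typ>\<open>nat extended\<close> without \<open>\<infinity>\<close>; on it the order and addition of
  that type follow the conventions \<open>-\<infinity> \<le> x\<close> and \<open>x + (-\<infinity>) = (-\<infinity>) + x = -\<infinity>\<close>.
\<close>

definition local_valuation ::
    "('v, 'e) wgraph \<Rightarrow> ('v \<Rightarrow> 'e) \<Rightarrow> (('v, 'e, 'r::ring_1) lpa_elem \<Rightarrow> nat extended) \<Rightarrow> bool" where
  "local_valuation G sp \<nu> \<longleftrightarrow>
     (\<forall>a \<in> lpa G. \<nu> a \<in> range Fin \<union> {-\<infinity>}) \<and>
     (\<forall>a \<in> lpa G. \<nu> a = -\<infinity> \<longleftrightarrow> a = lpa_zero G) \<and>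
     (\<forall>a \<in> lpa G. \<nu> a = Fin 0 \<longleftrightarrow> a \<noteq> lpa_zero G \<and> supp G sp a \<subseteq> {[Vert v] | v. v \<in> verts G}) \<and>
     (\<forall>a \<in> lpa G. \<forall>b \<in> lpa G. \<nu> (lpa_add G a b) \<le> max (\<nu> a) (\<nu> b)) \<and>
     (\<forall>v \<in> verts G.
        \<forall>a \<in> {lpa_mult G x (lpa_vertex G v) | x. x \<in> lpa G}.
        \<forall>b \<in> {lpa_mult G (lpa_vertex G v) y | y. y \<in> lpa G}.
          \<nu> (lpa_mult G a b) = \<nu> a + \<nu> b)"

definition max_length_valuation ::
    "('v, 'e) wgraph \<Rightarrow> ('v \<Rightarrow> 'e) \<Rightarrow> ('v, 'e, 'r::ring_1) lpa_elem \<Rightarrow> nat extended" where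
  "max_length_valuation G sp a =
     (if supp G sp a = {} then -\<infinity> else Fin (Max (path_length ` supp G sp a)))"

end

theory Submission
  imports Defs
begin

text \<open>Letters act from the right on the free module over the normal paths by concatenation followed by
  the rewriting rules
  \<open>\<alpha>\<^sup>v\<^sub>i (\<alpha>\<^sup>v\<^sub>j)\<^sup>* \<rightarrow> \<delta>\<^sub>i\<^sub>j v - \<Sum>\<gamma>\<noteq>\<alpha>\<^sup>v. \<gamma>\<^sub>i \<gamma>\<^sub>j\<^sup>*\<close> and
  \<open>\<alpha>\<^sub>1\<^sup>* \<beta>\<^sub>1 \<rightarrow> \<delta>\<^sub>\<alpha>\<^sub>\<beta> r(\<alpha>) - \<Sum>k\<ge>2. \<alpha>\<^sub>k\<^sup>* \<beta>\<^sub>k\<close>. This action satisfies the defining relations, so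
  acting on the empty word yields a linear map that vanishes on the ideal and is the identity on
  normal paths; hence normal forms exist and are unique.

  In the product of two normal paths \<open>p\<close> and \<open>q\<close> the part of length \<open>|p| + |q|\<close> is \<open>pq\<close>, or comes from a
  single rewriting step at the junction. Let \<open>P\<close> and \<open>Q\<close> be the longest paths in the supports of \<open>a\<close>
  and \<open>b\<close>. If some pair in \<open>P \<times> Q\<close> is not a redex, a suitable word \<open>pq\<close> occurs exactly once in \<open>ab\<close>. Otherwise
  all pairs are redexes of the same kind, and a word obtained by replacing \<open>\<alpha>\<^sup>v\<close> by another edge of maximal
  weight, or the index \<open>1\<close> by \<open>2\<close>, occurs exactly once. This is where the LV conditions enter.\<close>

section \<open>Linear extension\<close>

abbreviation keys where "keys \<equiv> Poly_Mapping.keys"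
abbreviation lookup where "lookup \<equiv> Poly_Mapping.lookup"
abbreviation single where "single \<equiv> Poly_Mapping.single"

lemma lookup_scale [simp]: "lookup (scale r f) w = r * lookup f w"
  unfolding scale_def mult_map_scale_conv_mult[symmetric] by (simp add: Poly_Mapping.map.rep_eq when_def)

lemma scale_single [simp]: "scale r (single w s) = single w (r * s)"
  by (simp add: scale_def mult_single)

lemma scale_zero_right [simp]: "scale r 0 = 0"
  and scale_zero_left [simp]: "scale 0 f = 0"
  and scale_one [simp]: "scale 1 f = f"
  and scale_add_left: "scale (r + s) f = scale r f + scale s f"
  and scale_diff_right: "scale r (f - g) = scale r f - scale r g"
  and scale_scale: "scale r (scale s f) = scale (r * s) f"
  by (simp_all add: scale_def distrib_right right_diff_distrib single_add mult_single flip: mult.assoc)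

lemma scale_sum: "scale r (\<Sum>x\<in>A. f x) = (\<Sum>x\<in>A. scale r (f x))"
  by (simp add: scale_def sum_distrib_left)

lemma keys_scale: "keys (scale r f) \<subseteq> keys f"
  by (auto simp: in_keys_iff)

lemma keys_sum: "keys (\<Sum>x\<in>A. f x) \<subseteq> (\<Union>x\<in>A. keys (f x))"
proof
  fix k assume "k \<in> keys (sum f A)"
  then have "(\<Sum>x\<in>A. lookup (f x) k) \<noteq> 0" by (simp add: in_keys_iff lookup_sum)
  then show "k \<in> (\<Union>x\<in>A. keys (f x))" by (auto simp: in_keys_iff dest: sum.not_neutral_contains_not_neutral)
qed

lemma keys_diff: "keys (f - g) \<subseteq> keys f \<union> keys g"
  for f g :: "'a \<Rightarrow>\<^sub>0 'b::ab_group_add"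
  by (auto simp: in_keys_iff lookup_minus)

lemma keys_diff_sum: "keys (f - (\<Sum>x\<in>A. g x)) \<subseteq> keys f \<union> (\<Union>x\<in>A. keys (g x))"
  for f :: "'a \<Rightarrow>\<^sub>0 'b::ab_group_add"
  using keys_diff[of f "sum g A"] keys_sum[of g A] by blast

text \<open>The coefficient ring may be noncommutative, so these are left linear maps. Two of them
  agree as soon as they agree on words, which is how the operator identities below are
  checked.\<close>

definition lin ::
    "(('v, 'e) letter list \<Rightarrow> ('v, 'e, 'r::ring_1) free_elem) \<Rightarrow> ('v, 'e, 'r) free_elem \<Rightarrow> ('v, 'e, 'r) free_elem"
  where "lin F f = (\<Sum>w\<in>keys f. scale (lookup f w) (F (letters w)))"

lemma lin_superset:
  assumes "finite S" "keys f \<subseteq> S"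
  shows "lin F f = (\<Sum>w\<in>S. scale (lookup f w) (F (letters w)))"
  unfolding lin_def using assms by (intro sum.mono_neutral_left) (auto simp: in_keys_iff)

lemma lin_add: "lin F (f + g) = lin F f + lin F g"
proof -
  let ?S = "keys f \<union> keys g"
  have "keys (f + g) \<subseteq> ?S" by (rule keys_add)
  then show ?thesis
    by (simp add: lin_superset[of ?S] lookup_add scale_add_left sum.distrib)
qed

lemma lin_zero [simp]: "lin F 0 = 0"
  by (simp add: lin_def)

lemma lin_scale: "lin F (scale r f) = scale r (lin F f)"
proof -
  have "lin F (scale r f) = (\<Sum>w\<in>keys f. scale (r * lookup f w) (F (letters w)))"
    by (simp add: lin_superset[OF _ keys_scale])
  then show ?thesis by (simp add: lin_def scale_sum scale_scale)
qed

lemma lin_uminus: "lin F (- f) = - lin F f"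
  using lin_scale[of F "- 1" f] by (simp add: scale_minus_one)

lemma lin_diff: "lin F (f - g) = lin F f - lin F g"
  using lin_add[of F f "- g"] by (simp add: lin_uminus)

lemma lin_sum: "lin F (\<Sum>x\<in>A. f x) = (\<Sum>x\<in>A. lin F (f x))"
  by (induction A rule: infinite_finite_induct) (auto simp: lin_add)

lemma lin_single [simp]: "lin F (single w r) = scale r (F (letters w))"
  by (cases "r = 0") (auto simp: lin_def)

lemma lin_cong: "(\<And>w. w \<in> keys f \<Longrightarrow> F (letters w) = H (letters w)) \<Longrightarrow> lin F f = lin H f"
  by (simp add: lin_def)

lemma lin_eq_0: "(\<And>w. w \<in> keys f \<Longrightarrow> F (letters w) = 0) \<Longrightarrow> lin F f = 0"
  by (simp add: lin_def)

lemma lin_fun_sum: "lin (\<lambda>w. \<Sum>x\<in>A. F x w) f = (\<Sum>x\<in>A. lin (F x) f)"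
  unfolding lin_def scale_sum by (rule sum.swap)

lemma lin_lin: "lin F (lin H f) = lin (\<lambda>w. lin F (H w)) f"
  by (simp add: lin_def[of H] lin_sum lin_scale, simp add: lin_def)

lemma lin_word_id [simp]: "lin (\<lambda>u. single (Word u) 1) f = f"
  by (rule poly_mapping_eqI)
    (auto simp: lin_def lookup_sum lookup_single when_def in_keys_iff if_distrib cong: if_cong)

lemma lookup_lin: "lookup (lin F f) w = (\<Sum>u\<in>keys f. lookup f u * lookup (F (letters u)) w)"
  by (simp add: lin_def lookup_sum)

lemma keys_lin: "keys (lin F f) \<subseteq> (\<Union>w\<in>keys f. keys (F (letters w)))"
  unfolding lin_def using keys_sum keys_scale by fastforce

lemma mult_word_lin: "f * single (Word w) 1 = lin (\<lambda>u. single (Word (u @ w)) 1) f"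
proof -
  have "f * single (Word w) 1 = lin (\<lambda>w. single (Word w) 1) f * single (Word w) 1" by simp
  also have "\<dots> = lin (\<lambda>u. single (Word (u @ w)) 1) f"
    unfolding lin_def sum_distrib_right by (simp add: mult_single plus_free_word_def)
  finally show ?thesis .
qed

lemma times_eq_sum_single:
  fixes f g :: "('v, 'e, 'r::ring_1) free_elem"
  shows "f * g = (\<Sum>u\<in>keys f. \<Sum>w\<in>keys g. single (u + w) (lookup f u * lookup g w))"
proof -
  have "f * g = lin (\<lambda>w. single (Word w) 1) f * lin (\<lambda>w. single (Word w) 1) g" by simp
  then show ?thesis
    unfolding lin_def sum_product by (simp add: mult_single)
qed

section \<open>Letters acting on normal paths\<close>

text \<open>The parameter \<open>coeff\<close> only fixes the coefficient ring.\<close>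

locale weighted_graph_choice = weighted_graph G for G :: "('v, 'e) wgraph" +
  fixes sp :: "'v \<Rightarrow> 'e" and coeff :: "'r::ring_1 itself"
  assumes special_choice: "special_choice G sp"
begin

section \<open>Redexes, based normal words and the definition of the action\<close>

definition special :: "'e \<Rightarrow> bool" where
  "special \<alpha> \<longleftrightarrow> \<alpha> \<in> sedges G \<and> sp (src G \<alpha>) = \<alpha>"

lemma finite_out [simp, intro]: "finite (out_sedges G v)"
proof (cases "v \<in> verts G")
  case False
  then have "out_sedges G v = {}" using src_in_verts by (auto simp: out_sedges_def)
  then show ?thesis by simp
qed (rule row_finite)

lemma weight_le_vweight: "\<alpha> \<in> sedges G \<Longrightarrow> weight G \<alpha> \<le> vweight G (src G \<alpha>)"
  unfolding vweight_def by (rule Max_ge, rule finite_imageI, rule finite_out) (simp add: out_sedges_def)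

lemma not_sink_iff: "\<not> sink G v \<longleftrightarrow> (\<exists>\<alpha>\<in>sedges G. src G \<alpha> = v)"
  by (auto simp: sink_def out_sedges_def)

lemma sp_props:
  assumes "v \<in> verts G" "\<not> sink G v"
  shows "sp v \<in> sedges G" "src G (sp v) = v" "weight G (sp v) = vweight G v" "special (sp v)"
  using special_choice assms unfolding special_choice_def special_def by auto

lemma special_weight: "special \<alpha> \<Longrightarrow> weight G \<alpha> = vweight G (src G \<alpha>)"
  using special_choice src_in_verts not_sink_iff unfolding special_choice_def special_def by metis

text \<open>The left-hand sides of the two rewriting rules. Index ranges and composability come from
  elsewhere: from membership in the alphabet and from the endpoint condition in
  \<open>linked\<close>.\<close>

fun redex :: "('v, 'e) letter \<Rightarrow> ('v, 'e) letter \<Rightarrow> bool" where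
  "redex (Edge \<alpha> i) (Ghost \<beta> j) \<longleftrightarrow> \<alpha> = \<beta> \<and> special \<alpha>"
| "redex (Ghost \<alpha> i) (Edge \<beta> j) \<longleftrightarrow> i = 1 \<and> j = 1"
| "redex _ _ \<longleftrightarrow> False"

definition linked :: "('v, 'e) letter \<Rightarrow> ('v, 'e) letter \<Rightarrow> bool" where
  "linked x y \<longleftrightarrow> letter_tgt G x = letter_src G y \<and> \<not> redex x y"

text \<open>Normal paths are represented with their source vertex as an additional first letter, so that
  paths of length \<open>0\<close> and the shortening of a path to length \<open>0\<close> need no special treatment.\<close>

definition based_normal :: "('v, 'e) letter list \<Rightarrow> bool" where
  "based_normal w \<longleftrightarrow> (\<exists>v l. w = Vert v # l \<and> v \<in> verts G \<and> set l \<subseteq> edge_letters G) \<and> successively linked w"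

text \<open>The value \<open>0\<close> outside the alphabet is the convention that
  \<open>\<alpha>\<^sub>i\<close> and its ghost vanish for indices above the weight of \<alpha>.
  Sums over all edges at a vertex, or over all indices up to a maximum, then need no side
  conditions.\<close>

definition mon :: "('v, 'e) letter list \<Rightarrow> ('v, 'e, 'r) free_elem" where
  "mon w = (if set w \<subseteq> alphabet G then single (Word w) 1 else 0)"

text \<open>The normal form of \<open>p y x\<close> for a normal path \<open>p y\<close> and a composable letter \<open>x\<close>; on the empty
  word, \<open>act\<close> starts at the source of \<open>x\<close>. Rewriting the last redex never creates another one, so
  no recursion is needed.\<close>

fun step :: "('v, 'e) letter list \<Rightarrow> ('v, 'e) letter \<Rightarrow> ('v, 'e) letter \<Rightarrow> ('v, 'e, 'r) free_elem" where
  "step p (Edge \<alpha> i) (Ghost \<beta> j) =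
     (if \<alpha> = \<beta> \<and> special \<alpha>
      then (if i = j then mon p else 0) - (\<Sum>\<gamma>\<in>out_sedges G (src G \<alpha>) - {\<alpha>}. mon (p @ [Edge \<gamma> i, Ghost \<gamma> j]))
      else mon (p @ [Edge \<alpha> i, Ghost \<beta> j]))"
| "step p (Ghost \<alpha> i) (Edge \<beta> j) =
     (if i = 1 \<and> j = 1
      then (if \<alpha> = \<beta> then mon p else 0) - (\<Sum>k\<in>{2..weight G \<alpha>}. mon (p @ [Ghost \<alpha> k, Edge \<beta> k]))
      else mon (p @ [Ghost \<alpha> i, Edge \<beta> j]))"
| "step p y (Vert v) = mon (p @ [y])"
| "step p y x = mon (p @ [y, x])"

definition act :: "('v, 'e) letter \<Rightarrow> ('v, 'e) letter list \<Rightarrow> ('v, 'e, 'r) free_elem" where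
  "act x u =
     (if x \<in> alphabet G then
        let u = (if u = [] then [Vert (letter_src G x)] else u)
        in if letter_tgt G (last u) = letter_src G x then step (butlast u) (last u) x else 0
      else 0)"

lemma in_edge_letters [simp]:
  "Edge \<alpha> i \<in> edge_letters G \<longleftrightarrow> \<alpha> \<in> sedges G \<and> i \<in> {1..weight G \<alpha>}"
  "Ghost \<alpha> i \<in> edge_letters G \<longleftrightarrow> \<alpha> \<in> sedges G \<and> i \<in> {1..weight G \<alpha>}"
  "Vert v \<notin> edge_letters G"
  by (auto simp: edge_letters_def)

lemma in_alphabet [simp]:
  "Edge \<alpha> i \<in> alphabet G \<longleftrightarrow> \<alpha> \<in> sedges G \<and> i \<in> {1..weight G \<alpha>}"
  "Ghost \<alpha> i \<in> alphabet G \<longleftrightarrow> \<alpha> \<in> sedges G \<and> i \<in> {1..weight G \<alpha>}"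
  "Vert v \<in> alphabet G \<longleftrightarrow> v \<in> verts G"
  by (auto simp: alphabet_def)

lemma edge_letters_alphabet: "edge_letters G \<subseteq> alphabet G"
  by (auto simp: alphabet_def)

lemma letter_src_in_verts: "x \<in> alphabet G \<Longrightarrow> letter_src G x \<in> verts G"
  by (cases x) (auto simp: src_in_verts tgt_in_verts)

lemma letter_tgt_in_verts: "x \<in> alphabet G \<Longrightarrow> letter_tgt G x \<in> verts G"
  by (cases x) (auto simp: src_in_verts tgt_in_verts)

lemma based_normal_append:
  assumes "w \<noteq> []"
  shows "based_normal (w @ u) \<longleftrightarrow>
    based_normal w \<and> set u \<subseteq> edge_letters G \<and> successively linked u \<and> (u = [] \<or> linked (last w) (hd u))"
  using assms by (cases w) (auto simp: based_normal_def successively_append_iff successively_Cons)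

lemma based_normal_singleton [simp]: "based_normal [x] \<longleftrightarrow> (\<exists>v\<in>verts G. x = Vert v)"
  by (auto simp: based_normal_def)

lemma based_normal_not_Nil [simp]: "\<not> based_normal []"
  by (auto simp: based_normal_def)

lemma based_normal_alphabet: "based_normal w \<Longrightarrow> set w \<subseteq> alphabet G"
  by (auto simp: based_normal_def alphabet_def)

lemma mon_based_normal: "based_normal w \<Longrightarrow> mon w = single (Word w) 1"
  by (simp add: mon_def based_normal_alphabet)

lemma mon_eq_0: "x \<in> set w \<Longrightarrow> x \<notin> alphabet G \<Longrightarrow> mon w = 0"
  by (auto simp: mon_def)

section \<open>Evaluating the action: linked letters, vertices and redexes\<close>

lemma act_Nil: "act x [] = act x [Vert (letter_src G x)]"
  by (simp add: act_def)

lemma act_not_alphabet: "x \<notin> alphabet G \<Longrightarrow> act x w = 0"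
  by (simp add: act_def)

lemma act_mismatch: "u \<noteq> [] \<Longrightarrow> letter_tgt G (last u) \<noteq> letter_src G x \<Longrightarrow> act x u = 0"
  by (simp add: act_def)

lemma act_linked:
  assumes "set u \<subseteq> alphabet G" "u \<noteq> []" "linked (last u) x" "x \<notin> range Vert"
  shows "act x u = mon (u @ [x])"
proof (cases "x \<in> alphabet G")
  case True
  obtain p y where u: "u = p @ [y]" using assms(2) by (cases u rule: rev_cases) auto
  show ?thesis using assms True by (cases y; cases x) (auto simp: act_def u linked_def)
next
  case False then show ?thesis using mon_eq_0[of x "u @ [x]"] by (simp add: act_not_alphabet)
qed

text \<open>Holds for every \<open>u\<close>, because both sides vanish when a letter of
  \<open>u\<close> lies outside the alphabet. This form can be summed over edges of different
  weights.\<close>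

lemma lin_act_linked:
  assumes "u \<noteq> []" "linked (last u) x" "x \<notin> range Vert"
  shows "lin (act x) (mon u) = mon (u @ [x])"
  using act_linked[OF _ assms] by (auto simp: mon_def)

lemma act_Vert:
  assumes "set u \<subseteq> alphabet G" "u \<noteq> []" "letter_tgt G (last u) = v"
  shows "act (Vert v) u = mon u"
proof -
  have "last u \<in> alphabet G" using assms(1,2) by (meson last_in_set subsetD)
  then have "v \<in> verts G" using assms(3) letter_tgt_in_verts by blast
  then show ?thesis using assms by (cases u rule: rev_cases) (auto simp: act_def)
qed

lemma lin_act_edge_ghost:
  assumes "special \<alpha>" "i \<in> {1..weight G \<alpha>}" "j \<in> {1..weight G \<alpha>}"
  shows "lin (act (Ghost \<alpha> j)) (mon (p @ [Edge \<alpha> i])) =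
    (if i = j then mon p else 0) - (\<Sum>\<gamma>\<in>out_sedges G (src G \<alpha>) - {\<alpha>}. mon (p @ [Edge \<gamma> i, Ghost \<gamma> j]))"
  using assms by (cases "set p \<subseteq> alphabet G") (auto simp: mon_def act_def special_def conj_ac intro!: sum.cong)

lemma lin_act_ghost_edge:
  assumes "\<alpha> \<in> sedges G" "\<beta> \<in> sedges G" "src G \<alpha> = src G \<beta>"
  shows "lin (act (Edge \<beta> 1)) (mon (p @ [Ghost \<alpha> 1])) =
    (if \<alpha> = \<beta> then mon p else 0) - (\<Sum>k\<in>{2..weight G \<alpha>}. mon (p @ [Ghost \<alpha> k, Edge \<beta> k]))"
  using assms weight_pos[of \<alpha>] weight_pos[of \<beta>] by (auto simp: mon_def act_def)

lemma lin_act_based_normal: "based_normal w \<Longrightarrow> lin (act x) (mon w) = act x w"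
  by (simp add: mon_based_normal)

lemma linked_Ghost_index: "linked y (Ghost \<alpha> i) \<Longrightarrow> linked y (Ghost \<alpha> j)"
  by (cases y) (auto simp: linked_def)

text \<open>Rewriting a redex \<open>yx\<close> inside \<open>p y x q\<close>, with \<open>p y\<close> and \<open>x q\<close> normal, yields normal words:
  a redex formed by \<open>p\<close> or \<open>q\<close> and a new letter would already be one with \<open>y\<close> or \<open>x\<close>.\<close>

lemma linked_replace_edge:
  assumes "linked y (Edge \<alpha> i)" "special \<alpha>" "src G \<gamma> = src G \<alpha>"
  shows "linked y (Edge \<gamma> i)"
  using assms by (cases y) (auto simp: linked_def)

lemma based_normal_rewrite_edge_ghost:
  assumes "based_normal (p @ [Edge \<alpha> i])" "special \<alpha>" "\<gamma> \<in> out_sedges G (src G \<alpha>) - {\<alpha>}"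
    and "i \<in> {1..weight G \<gamma>}" "j \<in> {1..weight G \<gamma>}"
  shows "based_normal (p @ [Edge \<gamma> i, Ghost \<gamma> j])"
proof -
  have "p \<noteq> []" using assms(1) by (cases p) auto
  \<comment> \<open>Each source has only one special edge, so the new pair
    \<open>Edge \<gamma> i\<close>, \<open>Ghost \<gamma> j\<close> is not a redex.\<close>
  moreover have "\<not> special \<gamma>" using assms(2,3) by (auto simp: special_def out_sedges_def)
  ultimately show ?thesis
    using assms linked_replace_edge[of "last p" \<alpha> i \<gamma>]
    by (auto simp: based_normal_append out_sedges_def linked_def[of "Edge _ _" "Ghost _ _"])
qed

lemma based_normal_rewrite_ghost_edge:
  assumes "based_normal (p @ [Ghost \<alpha> i])" "\<beta> \<in> sedges G" "src G \<beta> = src G \<alpha>"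
    and "k \<in> {2..weight G \<alpha>}" "k \<le> weight G \<beta>"
  shows "based_normal (p @ [Ghost \<alpha> k, Edge \<beta> k])"
proof -
  have "p \<noteq> []" using assms(1) by (cases p) auto
  then show ?thesis
    using assms linked_Ghost_index[of "last p" \<alpha> i k]
    by (auto simp: based_normal_append linked_def[of "Ghost _ _" "Edge _ _"])
qed

lemma act_edge_ghost:
  assumes "based_normal (p @ [Edge \<alpha> i])" "special \<alpha>" "j \<in> {1..weight G \<alpha>}"
  shows "act (Ghost \<alpha> j) (p @ [Edge \<alpha> i]) =
    (if i = j then mon p else 0) - (\<Sum>\<gamma>\<in>out_sedges G (src G \<alpha>) - {\<alpha>}. mon (p @ [Edge \<gamma> i, Ghost \<gamma> j]))"
proof -
  have "i \<in> {1..weight G \<alpha>}" using based_normal_alphabet[OF assms(1)] by simp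
  then show ?thesis
    unfolding lin_act_based_normal[OF assms(1), symmetric] by (intro lin_act_edge_ghost assms)
qed

lemma act_ghost_edge:
  assumes "based_normal (p @ [Ghost \<alpha> 1])" "\<beta> \<in> sedges G" "src G \<alpha> = src G \<beta>"
  shows "act (Edge \<beta> 1) (p @ [Ghost \<alpha> 1]) =
    (if \<alpha> = \<beta> then mon p else 0) - (\<Sum>k\<in>{2..weight G \<alpha>}. mon (p @ [Ghost \<alpha> k, Edge \<beta> k]))"
proof -
  have "\<alpha> \<in> sedges G" using based_normal_alphabet[OF assms(1)] by simp
  then show ?thesis
    unfolding lin_act_based_normal[OF assms(1), symmetric] by (intro lin_act_ghost_edge assms)
qed

lemma redex_cases:
  assumes "redex y x"
  obtains \<alpha> i j where "y = Edge \<alpha> i" "x = Ghost \<alpha> j" "special \<alpha>"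
  | \<alpha> \<beta> where "y = Ghost \<alpha> 1" "x = Edge \<beta> 1"
  using assms by (cases y; cases x) auto

text \<open>A vertex leaves the word unchanged, a linked letter is appended, and a redex is replaced
  either by the prefix \<open>p\<close> or by two letters that are linked with \<open>p\<close> and
  with each other. This is the invariant behind normality, matching endpoints and all length
  bounds.\<close>

lemma act_keys:
  assumes w: "based_normal w" and x: "x \<in> alphabet G" and u: "Word u \<in> keys (act x w)"
  shows "based_normal u \<and> hd u = hd w \<and> letter_tgt G (last u) = letter_tgt G x \<and> length u \<le> Suc (length w)"
proof -
  have w_ne: "w \<noteq> []" and w_al: "set w \<subseteq> alphabet G" using w based_normal_alphabet by auto
  have tgt: "letter_tgt G (last w) = letter_src G x"
    using u act_mismatch[OF w_ne] by (metis keys_zero empty_iff)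
  consider v where "x = Vert v" | "x \<notin> range Vert" "linked (last w) x" | "redex (last w) x"
    using tgt by (cases x) (auto simp: linked_def)
  then show ?thesis
  proof cases
    case 1
    then have "act x w = mon w" using act_Vert[OF w_al w_ne] tgt by simp
    then have "u = w" using u by (simp add: mon_based_normal w)
    then show ?thesis using w tgt 1 by auto
  next
    case 2
    then have "act x w = (mon (w @ [x]))" using act_linked[OF w_al w_ne] by blast
    then have "u = w @ [x]" using u by (auto simp: mon_def split: if_splits)
    then show ?thesis using 2 w x w_ne by (auto simp: based_normal_append alphabet_def)
  next
    case 3
    obtain p y where w_eq: "w = p @ [y]" using w_ne by (cases w rule: rev_cases) auto
    \<comment> \<open>A word with empty \<open>p\<close> consists of its base vertex, and a vertex
      letter is part of no redex.\<close>
    then have p: "p \<noteq> []" using w 3 by (cases p) (auto elim: redex_cases)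
    then have p': "based_normal p" "linked (last p) y" using w by (auto simp: w_eq based_normal_append)
    have "redex y x" using 3 w_eq by simp
    then show ?thesis
    proof (cases rule: redex_cases)
      case (1 \<alpha> i j)
      then have "act x w = (if i = j then mon p else 0) - (\<Sum>\<gamma>\<in>out_sedges G (src G \<alpha>) - {\<alpha>}. mon (p @ [Edge \<gamma> i, Ghost \<gamma> j]))"
        using act_edge_ghost[of p \<alpha> i j] w x by (simp add: w_eq)
      then have "keys (act x w) \<subseteq> keys (if i = j then mon p else 0) \<union> (\<Union>\<gamma>\<in>out_sedges G (src G \<alpha>) - {\<alpha>}. keys (mon (p @ [Edge \<gamma> i, Ghost \<gamma> j])))"
        by (simp only: keys_diff_sum)
      with u have "Word u \<in> keys (mon p) \<union> (\<Union>\<gamma>\<in>out_sedges G (src G \<alpha>) - {\<alpha>}. keys (mon (p @ [Edge \<gamma> i, Ghost \<gamma> j])))"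
        by (auto split: if_splits)
      then consider "u = p" | \<gamma> where "\<gamma> \<in> out_sedges G (src G \<alpha>) - {\<alpha>}" "u = p @ [Edge \<gamma> i, Ghost \<gamma> j]"
          "i \<in> {1..weight G \<gamma>}" "j \<in> {1..weight G \<gamma>}"
        by (auto simp: mon_def split: if_splits)
      then show ?thesis
      proof cases
        case 1
        \<comment> \<open>\<open>Ghost \<alpha> j\<close> ends where \<open>Edge \<alpha> i\<close>
          starts, and \<open>p\<close> ends there because it is linked with
          \<open>Edge \<alpha> i\<close>.\<close>
        then show ?thesis using p p' \<open>y = _\<close> \<open>x = _\<close> by (auto simp: w_eq linked_def)
      next
        case (2 \<gamma>)
        then show ?thesis
          using w p \<open>y = _\<close> \<open>x = _\<close> \<open>special \<alpha>\<close> based_normal_rewrite_edge_ghost[of p \<alpha> i \<gamma> j]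
          by (auto simp: w_eq out_sedges_def)
      qed
    next
      case (2 \<alpha> \<beta>)
      have src: "src G \<alpha> = src G \<beta>" "\<beta> \<in> sedges G" using tgt x by (auto simp: w_eq 2)
      have "act x w = (if \<alpha> = \<beta> then mon p else 0) - (\<Sum>k\<in>{2..weight G \<alpha>}. mon (p @ [Ghost \<alpha> k, Edge \<beta> k]))"
        using act_ghost_edge[of p \<alpha> \<beta>] w src by (simp add: w_eq 2)
      then have "keys (act x w) \<subseteq> keys (if \<alpha> = \<beta> then mon p else 0) \<union> (\<Union>k\<in>{2..weight G \<alpha>}. keys (mon (p @ [Ghost \<alpha> k, Edge \<beta> k])))"
        by (simp only: keys_diff_sum)
      with u have "Word u \<in> (if \<alpha> = \<beta> then keys (mon p) else {}) \<union> (\<Union>k\<in>{2..weight G \<alpha>}. keys (mon (p @ [Ghost \<alpha> k, Edge \<beta> k])))"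
        by (auto split: if_splits)
      then consider "u = p" "\<alpha> = \<beta>" | k where "k \<in> {2..weight G \<alpha>}" "k \<le> weight G \<beta>" "u = p @ [Ghost \<alpha> k, Edge \<beta> k]"
        by (auto simp: mon_def split: if_splits)
      then show ?thesis
      proof cases
        case 1
        then show ?thesis using p p' 2 by (auto simp: w_eq linked_def)
      next
        case (2 k)
        then show ?thesis
          using w p \<open>y = _\<close> \<open>x = _\<close> src based_normal_rewrite_ghost_edge[of p \<alpha> 1 \<beta> k]
          by (auto simp: w_eq)
      qed
    qed
  qed
qed

text \<open>For a word ending at \<open>v\<close>, the rewriting of the summand for
  \<open>sp v\<close> cancels the other summands. The overlap to be resolved is
  \<open>w = p @ [Ghost \<beta> 1]\<close> with \<open>i = 1\<close>, where the first letter of the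
  relation already triggers a rewriting step and the cancellation has to be applied once for each
  resulting index \<open>k\<close>.\<close>

lemma act_edge_ghost_relation:
  assumes w: "based_normal w" and v: "v \<in> verts G" "\<not> sink G v"
    and ij: "i \<in> {1..vweight G v}" "j \<in> {1..vweight G v}"
  shows "(\<Sum>\<alpha>\<in>out_sedges G v. lin (act (Ghost \<alpha> j)) (act (Edge \<alpha> i) w)) = (if i = j then act (Vert v) w else 0)"
proof (cases "letter_tgt G (last w) = v")
  case False
  moreover have "w \<noteq> []" using w by auto
  ultimately show ?thesis by (auto simp: act_mismatch out_sedges_def intro!: sum.neutral)
next
  case tgt: True
  let ?s = "sp v" and ?O = "out_sedges G v"
  have w_ne: "w \<noteq> []" and w_al: "set w \<subseteq> alphabet G" using w based_normal_alphabet by auto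
  note s = sp_props[OF v]
  have sO: "?s \<in> ?O" using s by (simp add: out_sedges_def)
  have idx: "i \<in> {1..weight G ?s}" "j \<in> {1..weight G ?s}" using ij s by auto
  have not_sp: "\<not> special \<alpha>" if "\<alpha> \<in> ?O - {?s}" for \<alpha> using that by (auto simp: special_def out_sedges_def)
  \<comment> \<open>The summand for \<open>sp v\<close> is rewritten into the vertex term minus
    exactly the remaining summands, which are linked and hence unchanged.\<close>
  have *: "(\<Sum>\<alpha>\<in>?O. lin (act (Ghost \<alpha> j)) (mon (u @ [Edge \<alpha> k]))) = (if k = j then mon u else 0)"
    if k: "k \<in> {1..weight G ?s}" for u k
  proof -
    have "(\<Sum>\<alpha>\<in>?O - {?s}. lin (act (Ghost \<alpha> j)) (mon (u @ [Edge \<alpha> k])))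
      = (\<Sum>\<alpha>\<in>?O - {?s}. mon (u @ [Edge \<alpha> k, Ghost \<alpha> j]))"
      by (intro sum.cong refl) (subst lin_act_linked, use not_sp in \<open>auto simp: linked_def\<close>)
    then show ?thesis
      unfolding sum.remove[OF finite_out sO]
      using lin_act_edge_ghost[OF s(4) k idx(2)] by (simp add: s)
  qed
  show ?thesis
  proof (cases "\<exists>p \<beta>. w = p @ [Ghost \<beta> 1] \<and> i = 1")
    case False
    have "act (Edge \<alpha> i) w = mon (w @ [Edge \<alpha> i])" if "\<alpha> \<in> ?O" for \<alpha>
    proof (rule act_linked[OF w_al w_ne])
      have "\<not> redex (last w) (Edge \<alpha> i)"
      proof
        assume "redex (last w) (Edge \<alpha> i)"
        then obtain \<beta> where "last w = Ghost \<beta> 1" "i = 1" by (cases "last w") auto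
        with False append_butlast_last_id[OF w_ne] show False by metis
      qed
      then show "linked (last w) (Edge \<alpha> i)" using that tgt by (auto simp: linked_def out_sedges_def)
    qed auto
    then show ?thesis using *[OF idx(1), of w] by (simp add: act_Vert w_al w_ne tgt)
  next
    case True
    then obtain p \<beta> where w_eq: "w = p @ [Ghost \<beta> 1]" and i: "i = 1" by blast
    with w have p: "p \<noteq> []" "based_normal p" "linked (last p) (Ghost \<beta> 1)" "\<beta> \<in> sedges G"
      by (cases "p = []"; auto simp: based_normal_append)+
    have \<beta>: "\<beta> \<in> ?O" using tgt p by (auto simp: w_eq out_sedges_def)
    have act1: "act (Edge \<alpha> i) w = (if \<alpha> = \<beta> then mon p else 0) - (\<Sum>k\<in>{2..weight G \<beta>}. mon (p @ [Ghost \<beta> k, Edge \<alpha> k]))"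
      if "\<alpha> \<in> ?O" for \<alpha>
      using lin_act_ghost_edge[of \<beta> \<alpha> p] that \<beta> lin_act_based_normal[OF w] by (auto simp: out_sedges_def w_eq i)
    have act2: "lin (act (Ghost \<beta> j)) (mon p) = mon (p @ [Ghost \<beta> j])"
      using p linked_Ghost_index by (intro lin_act_linked) auto
    have "(\<Sum>\<alpha>\<in>?O. lin (act (Ghost \<alpha> j)) (act (Edge \<alpha> i) w))
      = (\<Sum>\<alpha>\<in>?O. (if \<alpha> = \<beta> then mon (p @ [Ghost \<beta> j]) else 0)
          - (\<Sum>k\<in>{2..weight G \<beta>}. lin (act (Ghost \<alpha> j)) (mon ((p @ [Ghost \<beta> k]) @ [Edge \<alpha> k]))))"
      by (rule sum.cong) (auto simp: act1 lin_diff lin_sum act2)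
    also have "\<dots> = mon (p @ [Ghost \<beta> j])
        - (\<Sum>k\<in>{2..weight G \<beta>}. \<Sum>\<alpha>\<in>?O. lin (act (Ghost \<alpha> j)) (mon ((p @ [Ghost \<beta> k]) @ [Edge \<alpha> k])))"
      unfolding sum_subtractf using \<beta> by (subst (2) sum.swap) simp
    \<comment> \<open>The cancellation applies to every \<open>k\<close> here, since the weight of
      \<beta> is at most the weight of \<open>sp v\<close>.\<close>
    also have "\<dots> = mon (p @ [Ghost \<beta> j]) - (\<Sum>k\<in>{2..weight G \<beta>}. if k = j then mon (p @ [Ghost \<beta> k]) else 0)"
      using weight_le_vweight[OF p(4)] \<beta> by (subst sum.cong[OF refl *]) (auto simp: s out_sedges_def)
    \<comment> \<open>For \<open>j = 1\<close> the sum has no nonzero term. For larger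
      \<open>j\<close> it cancels the leading term, or \<open>j\<close> exceeds the weight of
      \<beta> and the leading term is itself zero.\<close>
    also have "\<dots> = (if i = j then mon w else 0)"
      using ij mon_eq_0[of "Ghost \<beta> j" "p @ [Ghost \<beta> j]"] by (auto simp: i w_eq)
    finally show ?thesis by (simp add: act_Vert w_al w_ne tgt)
  qed
qed

text \<open>The mirror image: the rewriting of the summand with index 1 cancels the other summands.
  The overlap to be resolved is a word ending in a special \<open>Edge \<alpha> l\<close>, where
  \<open>Ghost \<alpha> i\<close> already triggers a rewriting step and the cancellation is applied
  once for each other edge \<gamma> at the source of \<alpha>.\<close>

lemma act_ghost_edge_relation:
  assumes w: "based_normal w" and \<alpha>: "\<alpha> \<in> sedges G" and \<beta>: "\<beta> \<in> sedges G"
  shows "(\<Sum>i\<in>{1..max (weight G \<alpha>) (weight G \<beta>)}. lin (act (Edge \<beta> i)) (act (Ghost \<alpha> i) w))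
    = (if \<alpha> = \<beta> then act (Vert (tgt G \<alpha>)) w else 0)"
proof (cases "letter_tgt G (last w) = tgt G \<alpha> \<and> src G \<alpha> = src G \<beta>")
  case False
  have "lin (act (Edge \<beta> i)) (act (Ghost \<alpha> i) w) = 0" for i
  proof (cases "letter_tgt G (last w) = tgt G \<alpha> \<and> Ghost \<alpha> i \<in> alphabet G")
    case True
    show ?thesis
    proof (rule lin_eq_0)
      fix u assume "u \<in> keys (act (Ghost \<alpha> i) w)"
      then have "Word (letters u) \<in> keys (act (Ghost \<alpha> i) w)" by simp
      from act_keys[OF w conjunct2[OF True] this]
      have "letters u \<noteq> [] \<and> letter_tgt G (last (letters u)) = src G \<alpha>" by auto
      with False True show "act (Edge \<beta> i) (letters u) = 0"
        by (intro act_mismatch) auto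
    qed
  next
    case False
    then have "act (Ghost \<alpha> i) w = 0"
      using w act_not_alphabet act_mismatch[of w] by (metis based_normal_not_Nil letter_src.simps(3))
    then show ?thesis by simp
  qed
  moreover have "act (Vert (tgt G \<alpha>)) w = 0" if "\<alpha> = \<beta>"
    using False that w by (intro act_mismatch) auto
  ultimately show ?thesis by auto
next
  case True
  then have tgt: "letter_tgt G (last w) = tgt G \<alpha>" and src: "src G \<alpha> = src G \<beta>" by auto
  let ?m = "max (weight G \<alpha>) (weight G \<beta>)"
  have w_ne: "w \<noteq> []" and w_al: "set w \<subseteq> alphabet G" using w based_normal_alphabet by auto
  \<comment> \<open>The term with \<open>i = 1\<close> becomes the vertex term minus the terms with
    larger index. Terms above the weight of \<gamma> are zero, so the bound \<open>?m\<close> can be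
    exchanged for that weight.\<close>
  have *: "(\<Sum>i\<in>{1..?m}. lin (act (Edge \<beta> i)) (mon (u @ [Ghost \<gamma> i]))) = (if \<gamma> = \<beta> then mon u else 0)"
    if \<gamma>: "\<gamma> \<in> sedges G" "src G \<gamma> = src G \<alpha>" "weight G \<gamma> \<le> ?m" for u \<gamma>
  proof -
    have "1 \<le> ?m" using weight_pos[OF \<alpha>] by simp
    then have m: "{1..?m} = insert 1 {2..?m}" by auto
    have "(\<Sum>i\<in>{2..?m}. lin (act (Edge \<beta> i)) (mon (u @ [Ghost \<gamma> i]))) = (\<Sum>i\<in>{2..?m}. mon (u @ [Ghost \<gamma> i, Edge \<beta> i]))"
      using src \<gamma> by (intro sum.cong refl) (subst lin_act_linked, auto simp: linked_def)
    also have "\<dots> = (\<Sum>i\<in>{2..weight G \<gamma>}. mon (u @ [Ghost \<gamma> i, Edge \<beta> i]))"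
      using \<gamma>(3) by (intro sum.mono_neutral_right) (auto intro: mon_eq_0[of "Ghost \<gamma> _"])
    finally show ?thesis
      using lin_act_ghost_edge[of \<gamma> \<beta> u] \<gamma> \<beta> src unfolding m by (subst sum.insert) auto
  qed
  show ?thesis
  proof (cases "special \<alpha> \<and> (\<exists>p l. w = p @ [Edge \<alpha> l])")
    case False
    have "act (Ghost \<alpha> i) w = mon (w @ [Ghost \<alpha> i])" for i
    proof (rule act_linked[OF w_al w_ne])
      have "\<not> redex (last w) (Ghost \<alpha> i)"
      proof
        assume "redex (last w) (Ghost \<alpha> i)"
        then obtain l where "last w = Edge \<alpha> l" "special \<alpha>" by (cases "last w") auto
        with False append_butlast_last_id[OF w_ne] show False by metis
      qed
      then show "linked (last w) (Ghost \<alpha> i)" using tgt by (auto simp: linked_def)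
    qed auto
    then show ?thesis using *[of \<alpha> w] \<alpha> by (simp add: act_Vert w_al w_ne tgt)
  next
    case True
    then obtain p l where sp: "special \<alpha>" and w_eq: "w = p @ [Edge \<alpha> l]" by blast
    with w have p: "p \<noteq> []" "based_normal p" "linked (last p) (Edge \<alpha> l)" and l: "l \<in> {1..weight G \<alpha>}"
      by (cases "p = []"; auto simp: based_normal_append)+
    let ?O = "out_sedges G (src G \<alpha>) - {\<alpha>}"
    \<comment> \<open>A special edge has maximal weight at its source, and \<beta> starts at the
      same vertex. Hence every index up to \<open>?m\<close> is in range for \<alpha>.\<close>
    have m: "?m = weight G \<alpha>"
      using weight_le_vweight[OF \<beta>] special_weight[OF sp] src by simp
    have act1: "act (Ghost \<alpha> i) w = (if l = i then mon p else 0) - (\<Sum>\<gamma>\<in>?O. mon (p @ [Edge \<gamma> l, Ghost \<gamma> i]))"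
      if "i \<in> {1..?m}" for i
      using lin_act_edge_ghost[OF sp l, of i p] that lin_act_based_normal[OF w] by (auto simp: w_eq m)
    have wm: "weight G \<gamma> \<le> ?m" if "\<gamma> \<in> ?O" for \<gamma>
      using that weight_le_vweight[of \<gamma>] special_weight[OF sp] by (simp add: out_sedges_def le_max_iff_disj)
    have inner: "(\<Sum>i\<in>{1..?m}. lin (act (Edge \<beta> i)) (mon ((p @ [Edge \<gamma> l]) @ [Ghost \<gamma> i])))
      = (if \<gamma> = \<beta> then mon (p @ [Edge \<gamma> l]) else 0)" if "\<gamma> \<in> ?O" for \<gamma>
      using that by (intro * wm) (auto simp: out_sedges_def)
    have \<beta>_out: "\<beta> \<in> out_sedges G (src G \<alpha>)" using \<beta> src by (simp add: out_sedges_def)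
    have act2: "lin (act (Edge \<beta> l)) (mon p) = mon (p @ [Edge \<beta> l])"
      using p linked_replace_edge sp src by (intro lin_act_linked) auto
    have "(\<Sum>i\<in>{1..?m}. lin (act (Edge \<beta> i)) (act (Ghost \<alpha> i) w))
      = (\<Sum>i\<in>{1..?m}. (if l = i then mon (p @ [Edge \<beta> l]) else 0)
           - (\<Sum>\<gamma>\<in>?O. lin (act (Edge \<beta> i)) (mon ((p @ [Edge \<gamma> l]) @ [Ghost \<gamma> i]))))"
      by (rule sum.cong) (auto simp: act1 lin_diff lin_sum act2)
    also have "\<dots> = mon (p @ [Edge \<beta> l])
       - (\<Sum>\<gamma>\<in>?O. \<Sum>i\<in>{1..?m}. lin (act (Edge \<beta> i)) (mon ((p @ [Edge \<gamma> l]) @ [Ghost \<gamma> i])))"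
      unfolding sum_subtractf using l by (subst (2) sum.swap) (simp add: m)
    also have "\<dots> = mon (p @ [Edge \<beta> l]) - (\<Sum>\<gamma>\<in>?O. if \<gamma> = \<beta> then mon (p @ [Edge \<gamma> l]) else 0)"
      by (intro arg_cong2[where f = "(-)"] sum.cong refl) (rule inner)
    \<comment> \<open>If \<beta> differs from \<alpha>, it is one of the \<gamma> and its term
      cancels the leading one; otherwise the sum vanishes and the leading term is
      \<open>w\<close>.\<close>
    also have "\<dots> = (if \<alpha> = \<beta> then mon w else 0)"
      using \<beta>_out by (auto simp: w_eq)
    finally show ?thesis by (simp add: act_Vert w_al w_ne tgt)
  qed
qed

end

section \<open>The ideal acts by zero\<close>

lemma word_mult_lin: "single (Word u) 1 * f = lin (\<lambda>w. single (Word (u @ w)) 1) f"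
proof -
  have "single (Word u) 1 * f = single (Word u) 1 * lin (\<lambda>w. single (Word w) 1) f" by simp
  also have "\<dots> = lin (\<lambda>w. single (Word (u @ w)) 1) f"
    unfolding lin_def sum_distrib_left by (simp add: mult_single plus_free_word_def)
  finally show ?thesis .
qed

lemma sum_single_eq: "(\<Sum>w\<in>keys f. single w (lookup f w)) = f"
  for f :: "('v, 'e, 'r::ring_1) free_elem"
  using lin_word_id[of f, unfolded lin_def] by simp

lemma successively_iff_sublist: "successively P p \<longleftrightarrow> (\<forall>x y. sublist [x, y] p \<longrightarrow> P x y)"
proof (induction p)
  case (Cons a p)
  then show ?case by (cases p) (auto simp: sublist_Cons_right)
qed simp

text \<open>Leads from the based representation back to generalised paths. A path of length 0 is its
  own base and is therefore kept.\<close>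

fun strip_base :: "('v, 'e) letter list \<Rightarrow> ('v, 'e) letter list" where
  "strip_base (v # x # l) = x # l"
| "strip_base l = l"

context weighted_graph_choice
begin

section \<open>The action of words and the normal form map\<close>

definition lact :: "('v, 'e) letter list \<Rightarrow> ('v, 'e, 'r) free_elem \<Rightarrow> ('v, 'e, 'r) free_elem" where
  "lact w m = foldl (\<lambda>m x. lin (act x) m) m w"

text \<open>Here \<open>1\<close> is the empty word. The resulting words still carry their base
  vertex, so that \<open>NF\<close> is obtained from \<open>nf\<close> by stripping the
  base.\<close>

definition nf :: "('v, 'e, 'r) free_elem \<Rightarrow> ('v, 'e, 'r) free_elem" where
  "nf f = lin (\<lambda>w. lact w 1) f"

lemma lact_simps [simp]: "lact [] m = m" "lact (x # w) m = lact w (lin (act x) m)"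
  by (simp_all add: lact_def)

lemma lact_append: "lact (u @ w) m = lact w (lact u m)"
  by (simp add: lact_def)

lemma lact_lin: "lact w (lin F f) = lin (\<lambda>u. lact w (F u)) f"
  by (induction w arbitrary: F) (simp_all add: lin_lin)

lemma lact_zero [simp]: "lact w 0 = 0"
  by (induction w) auto

lemma one_eq_word: "(1 :: ('v, 'e, 'r) free_elem) = single (Word []) 1"
  by (simp flip: single_one add: zero_free_word_def)

lemma nf_add: "nf (f + g) = nf f + nf g"
  and nf_diff: "nf (f - g) = nf f - nf g"
  and nf_sum: "nf (\<Sum>a\<in>A. h a) = (\<Sum>a\<in>A. nf (h a))"
  and nf_scale: "nf (scale r f) = scale r (nf f)"
  and nf_lin: "nf (lin F f) = lin (\<lambda>w. nf (F w)) f"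
  and nf_zero [simp]: "nf 0 = 0"
  and nf_word: "nf (single (Word w) 1) = lact w 1"
  by (simp_all add: nf_def lin_add lin_diff lin_sum lin_scale lin_lin)

text \<open>The empty word is allowed as the starting point of the action; once a letter has acted,
  only based normal words remain.\<close>

definition admissible :: "('v, 'e, 'r) free_elem \<Rightarrow> bool" where
  "admissible m \<longleftrightarrow> (\<forall>w\<in>keys m. letters w = [] \<or> based_normal (letters w))"

lemma act_keys_admissible:
  assumes "w = [] \<or> based_normal w" "Word u \<in> keys (act x w)"
  shows "based_normal u" "letter_tgt G (last u) = letter_tgt G x"
    "hd u = (if w = [] then Vert (letter_src G x) else hd w)" "length u \<le> (if w = [] then 2 else Suc (length w))"
    "x \<in> alphabet G"
proof -
  show x: "x \<in> alphabet G" using assms(2) act_not_alphabet[of x w] by fastforce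
  let ?w = "if w = [] then [Vert (letter_src G x)] else w"
  have "based_normal ?w" using assms(1) letter_src_in_verts[OF x] by auto
  moreover have "act x w = act x ?w" using act_Nil[of x] by auto
  ultimately have "based_normal u \<and> hd u = hd ?w \<and> letter_tgt G (last u) = letter_tgt G x \<and> length u \<le> Suc (length ?w)"
    using act_keys[of ?w x u] x assms(2) by simp
  then show "based_normal u" "letter_tgt G (last u) = letter_tgt G x"
    "hd u = (if w = [] then Vert (letter_src G x) else hd w)" "length u \<le> (if w = [] then 2 else Suc (length w))"
    by (auto split: if_splits)
qed

lemma admissible_lin_act: "admissible m \<Longrightarrow> admissible (lin (act x) m)"
  unfolding admissible_def
proof
  fix w assume m: "\<forall>w\<in>keys m. letters w = [] \<or> based_normal (letters w)" and "w \<in> keys (lin (act x) m)"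
  then obtain u where "u \<in> keys m" "w \<in> keys (act x (letters u))" using keys_lin by blast
  then show "letters w = [] \<or> based_normal (letters w)"
    using act_keys_admissible(1)[of "letters u" "letters w" x] m by auto
qed

lemma admissible_lact: "admissible m \<Longrightarrow> admissible (lact w m)"
  by (induction w arbitrary: m) (auto intro: admissible_lin_act)

lemma admissible_one [simp]: "admissible 1"
  by (auto simp: admissible_def one_eq_word)

lemma lin_act_not_alphabet: "x \<notin> alphabet G \<Longrightarrow> lin (act x) m = 0"
  by (rule lin_eq_0) (rule act_not_alphabet)

section \<open>Compatibility with the defining relations\<close>

lemma edge_elem_eq: "\<alpha> \<in> sedges G \<Longrightarrow> edge_elem G \<alpha> i = mon [Edge \<alpha> i]"
  and ghost_elem_eq: "\<alpha> \<in> sedges G \<Longrightarrow> ghost_elem G \<alpha> i = mon [Ghost \<alpha> i]"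
  and vertex_elem_eq: "v \<in> verts G \<Longrightarrow> vertex_elem v = mon [Vert v]"
  by (auto simp: edge_elem_def ghost_elem_def vertex_elem_def mon_def)

lemma mon_mult: "mon u * mon w = mon (u @ w)"
  by (auto simp: mon_def mult_single plus_free_word_def)

lemma lin_lact_mon: "lin (\<lambda>w. lact w m) (mon w) = lact w m"
proof (cases "set w \<subseteq> alphabet G")
  case False
  then obtain u x v where "w = u @ x # v" "x \<notin> alphabet G" by (meson in_set_conv_decomp subsetI)
  then have "lact w m = 0" by (simp add: lact_append lin_act_not_alphabet)
  then show ?thesis using False by (simp add: mon_def)
qed (simp add: mon_def)

lemma lin_eqI: "admissible m \<Longrightarrow> (\<And>w. w = [] \<or> based_normal w \<Longrightarrow> F w = H w) \<Longrightarrow> lin F m = lin H m"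
  by (rule lin_cong) (auto simp: admissible_def)

text \<open>Carries an identity over to the empty word: all letters that act first in a given
  relation have the same source \<open>v\<close>, so on them the empty word behaves like the trivial
  path at \<open>v\<close>.\<close>

lemma extend_to_Nil:
  assumes "\<And>w. based_normal w \<Longrightarrow> P w"
    and "v \<in> verts G" "P [Vert v] \<Longrightarrow> P []"
    and "w = [] \<or> based_normal w"
  shows "P w"
  using assms by auto

text \<open>Every word produced by \<open>x\<close> ends at the target of \<open>x\<close>, and a
  vertex acts there as the identity or as zero.\<close>

lemma lin_act_Vert_act:
  assumes "w = [] \<or> based_normal w"
  shows "lin (act (Vert v)) (act x w) = (if letter_tgt G x = v then act x w else 0)"
proof -
  have "act (Vert v) u = (if letter_tgt G x = v then single (Word u) 1 else 0)"
    if u: "Word u \<in> keys (act x w)" for u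
  proof -
    note u' = act_keys_admissible[OF assms u]
    then have "u \<noteq> []" by auto
    then show ?thesis
      using act_Vert[of u v] u' based_normal_alphabet[of u]
      by (auto simp: act_mismatch mon_based_normal)
  qed
  then have "lin (act (Vert v)) (act x w) = lin (\<lambda>u. if letter_tgt G x = v then single (Word u) 1 else 0) (act x w)"
    by (intro lin_cong) (metis free_word.collapse)
  then show ?thesis by (auto simp: lin_eq_0)
qed

lemma lin_act_Vert_lin_act:
  assumes "admissible m"
  shows "lin (act (Vert v)) (lin (act x) m) = (if letter_tgt G x = v then lin (act x) m else 0)"
proof -
  have "lin (act (Vert v)) (lin (act x) m) = lin (\<lambda>w. if letter_tgt G x = v then act x w else 0) m"
    unfolding lin_lin by (rule lin_eqI[OF assms]) (rule lin_act_Vert_act)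
  then show ?thesis by (auto simp: lin_eq_0)
qed

lemma lin_act_src:
  assumes "admissible m" "x \<in> alphabet G"
  shows "lin (act x) (lin (act (Vert (letter_src G x))) m) = lin (act x) m"
  unfolding lin_lin
proof (rule lin_eqI[OF assms(1)])
  fix w assume w: "w = [] \<or> based_normal w"
  let ?w = "if w = [] then [Vert (letter_src G x)] else w"
  have w': "based_normal ?w" using w letter_src_in_verts[OF assms(2)] by auto
  then have "?w \<noteq> []" by auto
  have "lin (act x) (act (Vert (letter_src G x)) ?w) = act x ?w"
  proof (cases "letter_tgt G (last ?w) = letter_src G x")
    case True
    then show ?thesis
      using act_Vert[OF based_normal_alphabet[OF w'] \<open>?w \<noteq> []\<close>] lin_act_based_normal[OF w'] by simp
  next
    case False
    then show ?thesis
      using act_mismatch[OF \<open>?w \<noteq> []\<close>, of x] act_mismatch[OF \<open>?w \<noteq> []\<close>, of "Vert (letter_src G x)"] by simp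
  qed
  then show "lin (act x) (act (Vert (letter_src G x)) w) = act x w"
    by (cases "w = []") (auto simp: act_Nil)
qed

lemma lin_act_tgt:
  assumes "admissible m"
  shows "lin (act (Vert (letter_tgt G x))) (lin (act x) m) = lin (act x) m"
  by (simp add: lin_act_Vert_lin_act[OF assms])

text \<open>It suffices to test the relations on words. Those that involve a vertex factor follow
  from the action of vertices, the two summation relations from
  \<open>act_edge_ghost_relation\<close> and \<open>act_ghost_edge_relation\<close>. A general
  admissible \<open>m\<close> allows for a word acting before the relation.\<close>

lemma lin_relation_eq_0:
  assumes "x \<in> lpa_relations G" "admissible m"
  shows "lin (\<lambda>w. lact w m) x = 0"
  using assms(1)
proof cases
  case (vert v v')
  then show ?thesis
    using lin_act_Vert_lin_act[OF assms(2), of v' "Vert v"]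
    by (simp add: vertex_elem_eq mon_mult lin_diff lin_lact_mon)
next
  case (edge_src \<alpha> i)
  have "Edge \<alpha> i \<in> alphabet G" using edge_src by simp
  then show ?thesis
    using edge_src lin_act_src[OF assms(2), of "Edge \<alpha> i"]
    by (simp add: vertex_elem_eq edge_elem_eq ghost_elem_eq mon_mult lin_diff lin_lact_mon src_in_verts tgt_in_verts)
next
  case (edge_tgt \<alpha> i)
  have "Edge \<alpha> i \<in> alphabet G" using edge_tgt by simp
  then show ?thesis
    using edge_tgt lin_act_tgt[OF assms(2), of "Edge \<alpha> i"]
    by (simp add: vertex_elem_eq edge_elem_eq ghost_elem_eq mon_mult lin_diff lin_lact_mon src_in_verts tgt_in_verts)
next
  case (ghost_src \<alpha> i)
  have "Ghost \<alpha> i \<in> alphabet G" using ghost_src by simp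
  then show ?thesis
    using ghost_src lin_act_src[OF assms(2), of "Ghost \<alpha> i"]
    by (simp add: vertex_elem_eq edge_elem_eq ghost_elem_eq mon_mult lin_diff lin_lact_mon src_in_verts tgt_in_verts)
next
  case (ghost_tgt \<alpha> i)
  have "Ghost \<alpha> i \<in> alphabet G" using ghost_tgt by simp
  then show ?thesis
    using ghost_tgt lin_act_tgt[OF assms(2), of "Ghost \<alpha> i"]
    by (simp add: vertex_elem_eq edge_elem_eq ghost_elem_eq mon_mult lin_diff lin_lact_mon src_in_verts tgt_in_verts)
next
  case (edge_ghost v i j)
  have "(\<Sum>\<alpha>\<in>out_sedges G v. lin (act (Ghost \<alpha> j)) (act (Edge \<alpha> i) w)) = (if i = j then act (Vert v) w else 0)"
    if "w = [] \<or> based_normal w" for w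
  proof (rule extend_to_Nil[OF _ edge_ghost(2) _ that])
    assume *: "(\<Sum>\<alpha>\<in>out_sedges G v. lin (act (Ghost \<alpha> j)) (act (Edge \<alpha> i) [Vert v])) = (if i = j then act (Vert v) [Vert v] else 0)"
    have "act (Edge \<alpha> i) [] = act (Edge \<alpha> i) [Vert v]" if "\<alpha> \<in> out_sedges G v" for \<alpha>
      using that act_Nil[of "Edge \<alpha> i"] by (simp add: out_sedges_def)
    then show "(\<Sum>\<alpha>\<in>out_sedges G v. lin (act (Ghost \<alpha> j)) (act (Edge \<alpha> i) [])) = (if i = j then act (Vert v) [] else 0)"
      using * act_Nil[of "Vert v"] by simp
  qed (rule act_edge_ghost_relation, use edge_ghost in auto)
  then have rel: "lin (\<lambda>w. \<Sum>\<alpha>\<in>out_sedges G v. lin (act (Ghost \<alpha> j)) (act (Edge \<alpha> i) w)) m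
      = lin (\<lambda>w. if i = j then act (Vert v) w else 0) m"
    by (rule lin_eqI[OF assms(2)])
  have "lin (\<lambda>w. lact w m) (\<Sum>\<alpha>\<in>out_sedges G v. edge_elem G \<alpha> i * ghost_elem G \<alpha> j)
    = (\<Sum>\<alpha>\<in>out_sedges G v. lin (\<lambda>w. lin (act (Ghost \<alpha> j)) (act (Edge \<alpha> i) w)) m)"
    unfolding lin_sum by (rule sum.cong) (auto simp: edge_elem_eq ghost_elem_eq out_sedges_def mon_mult lin_lact_mon lin_lin)
  also have "\<dots> = (if i = j then lin (act (Vert v)) m else 0)"
    unfolding lin_fun_sum[symmetric] rel by (auto intro: lin_eq_0)
  finally show ?thesis using edge_ghost by (simp add: lin_diff vertex_elem_eq lin_lact_mon)
next
  case (ghost_edge \<alpha> \<beta>)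
  let ?m = "max (weight G \<alpha>) (weight G \<beta>)"
  have "(\<Sum>i\<in>{1..?m}. lin (act (Edge \<beta> i)) (act (Ghost \<alpha> i) w)) = (if \<alpha> = \<beta> then act (Vert (tgt G \<alpha>)) w else 0)"
    if "w = [] \<or> based_normal w" for w
  proof (rule extend_to_Nil[OF _ tgt_in_verts[OF ghost_edge(2)] _ that])
    assume *: "(\<Sum>i\<in>{1..?m}. lin (act (Edge \<beta> i)) (act (Ghost \<alpha> i) [Vert (tgt G \<alpha>)])) = (if \<alpha> = \<beta> then act (Vert (tgt G \<alpha>)) [Vert (tgt G \<alpha>)] else 0)"
    then show "(\<Sum>i\<in>{1..?m}. lin (act (Edge \<beta> i)) (act (Ghost \<alpha> i) [])) = (if \<alpha> = \<beta> then act (Vert (tgt G \<alpha>)) [] else 0)"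
      by (simp add: act_Nil)
  qed (rule act_ghost_edge_relation, use ghost_edge in auto)
  then have rel: "lin (\<lambda>w. \<Sum>i\<in>{1..?m}. lin (act (Edge \<beta> i)) (act (Ghost \<alpha> i) w)) m
      = lin (\<lambda>w. if \<alpha> = \<beta> then act (Vert (tgt G \<alpha>)) w else 0) m"
    by (rule lin_eqI[OF assms(2)])
  have "lin (\<lambda>w. lact w m) (\<Sum>i\<in>{1..?m}. ghost_elem G \<alpha> i * edge_elem G \<beta> i)
    = (\<Sum>i\<in>{1..?m}. lin (\<lambda>w. lin (act (Edge \<beta> i)) (act (Ghost \<alpha> i) w)) m)"
    unfolding lin_sum using ghost_edge by (intro sum.cong) (auto simp: edge_elem_eq ghost_elem_eq out_sedges_def mon_mult lin_lact_mon lin_lin)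
  also have "\<dots> = (if \<alpha> = \<beta> then lin (act (Vert (tgt G \<alpha>))) m else 0)"
    unfolding lin_fun_sum[symmetric] rel by (auto intro: lin_eq_0)
  finally show ?thesis using ghost_edge by (simp add: lin_diff vertex_elem_eq tgt_in_verts lin_lact_mon)
qed

text \<open>As \<open>nf\<close> is only left linear, a scalar to the right of a relation has to be
  moved to the left of it. This is possible because relations have integer coefficients.\<close>

definition central :: "('v, 'e, 'r) free_elem \<Rightarrow> bool" where
  "central x \<longleftrightarrow> (\<forall>r. single 0 r * x = x * single 0 r)"

lemma central_mult:
  assumes "central x" "central y"
  shows "central (x * y)"
  unfolding central_def
proof
  fix r
  have "single 0 r * (x * y) = (single 0 r * x) * y" by (rule mult.assoc[symmetric])
  also have "\<dots> = (x * single 0 r) * y" using assms(1) by (simp add: central_def)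
  also have "\<dots> = x * (single 0 r * y)" by (rule mult.assoc)
  also have "\<dots> = x * (y * single 0 r)" using assms(2) by (simp add: central_def)
  finally show "single 0 r * (x * y) = x * y * single 0 r" by (simp only: mult.assoc)
qed

lemma central_intros:
  "central 0" "central x \<Longrightarrow> central y \<Longrightarrow> central (x + y)" "central x \<Longrightarrow> central y \<Longrightarrow> central (x - y)"
  "central x \<Longrightarrow> central y \<Longrightarrow> central (x * y)" "central (single w 1)"
  using central_mult by (simp_all add: central_def ring_distribs mult_single)

lemma central_sum: "(\<And>a. a \<in> A \<Longrightarrow> central (f a)) \<Longrightarrow> central (sum f A)"
  by (induction A rule: infinite_finite_induct) (auto intro: central_intros)

lemma central_relation: "x \<in> lpa_relations G \<Longrightarrow> central x"
  by (induction rule: lpa_relations.induct)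
    (auto simp: vertex_elem_def edge_elem_def ghost_elem_def intro!: central_intros central_sum)

text \<open>Stated for all contexts \<open>a\<close>, \<open>b\<close>, so that the property passes to the ideal.\<close>

lemma nf_context_relation:
  assumes "x \<in> lpa_relations G"
  shows "nf (a * x * b) = 0"
proof -
  have word: "nf (single u 1 * x * single w 1) = 0" for u w
  proof -
    obtain u' w' where uw: "u = Word u'" "w = Word w'" by (metis free_word.collapse)
    have "nf (single u 1 * x * single w 1) = lin (\<lambda>c. nf (single (Word (u' @ c @ w')) 1)) x"
      unfolding uw word_mult_lin mult_word_lin lin_lin nf_lin by simp
    \<comment> \<open>The word to the left of the relation becomes the starting element
      \<open>lact u' 1\<close>, the word to the right acts on the result.\<close>
    also have "\<dots> = lact w' (lin (\<lambda>c. lact c (lact u' 1)) x)"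
      by (simp add: nf_word lact_append lact_lin)
    also have "\<dots> = 0"
      using lin_relation_eq_0[OF assms admissible_lact] by simp
    finally show ?thesis .
  qed
  have single: "nf (single u r * x * single w s) = 0" for u w r s
  proof -
    have "single u r * x * single w s = single 0 r * single u 1 * (x * single 0 s) * single w 1"
      by (simp add: mult_single mult.assoc)
    \<comment> \<open>Centrality of the relation brings the right-hand coefficient to the front,
      where \<open>nf\<close> is linear.\<close>
    also have "x * single 0 s = single 0 s * x"
      using central_relation[OF assms] by (simp add: central_def)
    also have "single 0 r * single u 1 * (single 0 s * x) = single 0 (r * s) * (single u 1 * x)"
      by (simp add: mult_single flip: mult.assoc)
    finally show ?thesis
      using nf_scale[of "r * s" "single u 1 * x * single w 1"] word[of u w]
      by (simp add: scale_def mult.assoc)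
  qed
  have "a * x * b = (\<Sum>u\<in>keys a. single u (lookup a u)) * x * (\<Sum>w\<in>keys b. single w (lookup b w))"
    by (simp add: sum_single_eq)
  then show ?thesis
    by (simp add: sum_distrib_left sum_distrib_right nf_sum single)
qed

lemma nf_context_ideal: "x \<in> lpa_ideal G \<Longrightarrow> nf (a * x * b) = 0"
proof (induction arbitrary: a b rule: lpa_ideal.induct)
  case (scale x r)
  then show ?case using scale.IH[of "a * single 0 r" b] by (simp add: scale_def mult.assoc)
next
  case (left f x)
  then show ?case using left.IH[of "a * f" b] by (simp add: mult.assoc)
next
  case (right x f)
  then show ?case using right.IH[of a "f * b"] by (simp add: mult.assoc)
qed (auto simp: nf_context_relation distrib_left distrib_right nf_add)

lemma nf_ideal: "x \<in> lpa_ideal G \<Longrightarrow> nf x = 0"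
  using nf_context_ideal[of x 1 1] by simp

section \<open>Normal forms\<close>

definition cong_ideal :: "('v, 'e, 'r) free_elem \<Rightarrow> ('v, 'e, 'r) free_elem \<Rightarrow> bool" (infix "\<approx>" 50) where
  "f \<approx> g \<longleftrightarrow> f - g \<in> lpa_ideal G"

lemma cong_refl [simp, intro]: "f \<approx> f"
  by (simp add: cong_ideal_def lpa_ideal.zero)

lemma cong_sym: "f \<approx> g \<Longrightarrow> g \<approx> f"
  using lpa_ideal_uminus[of "f - g" G] by (simp add: cong_ideal_def)

lemma cong_add: "f \<approx> g \<Longrightarrow> f' \<approx> g' \<Longrightarrow> f + f' \<approx> g + g'"
  using lpa_ideal.add[of "f - g" G "f' - g'"] by (simp add: cong_ideal_def diff_add_diff_swap)

lemma cong_trans [trans]: "f \<approx> g \<Longrightarrow> g \<approx> h \<Longrightarrow> f \<approx> h"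
  using lpa_ideal.add[of "f - g" G "g - h"] by (simp add: cong_ideal_def)

lemma cong_uminus: "f \<approx> g \<Longrightarrow> - f \<approx> - g"
  using lpa_ideal_uminus[of "f - g" G] by (simp add: cong_ideal_def)

lemma cong_diff: "f \<approx> g \<Longrightarrow> f' \<approx> g' \<Longrightarrow> f - f' \<approx> g - g'"
  using cong_add[OF _ cong_uminus, of f g f' g'] by simp

lemma cong_scale: "f \<approx> g \<Longrightarrow> scale r f \<approx> scale r g"
  using lpa_ideal.scale[of "f - g" G r] by (simp add: cong_ideal_def scale_diff_right)

lemma cong_sum: "(\<And>a. a \<in> A \<Longrightarrow> f a \<approx> g a) \<Longrightarrow> sum f A \<approx> sum g A"
  by (induction A rule: infinite_finite_induct) (auto intro: cong_add)

lemma cong_lin: "(\<And>w. w \<in> keys f \<Longrightarrow> F (letters w) \<approx> H (letters w)) \<Longrightarrow> lin F f \<approx> lin H f"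
  unfolding lin_def by (intro cong_sum cong_scale)

lemma word_in_free_ring: "w \<noteq> [] \<Longrightarrow> set w \<subseteq> alphabet G \<Longrightarrow> single (Word w) r \<in> free_ring G"
  by (auto simp: free_ring_def)

text \<open>The ideal absorbs elements of the free ring, which excludes the empty word; that word is
  the unit of the ambient ring and is treated separately.\<close>

lemma cong_word_left:
  assumes "f \<approx> g" "set u \<subseteq> alphabet G"
  shows "single (Word u) 1 * f \<approx> single (Word u) 1 * g"
proof (cases "u = []")
  case False
  from lpa_ideal.left[OF word_in_free_ring[OF this assms(2)]] assms(1) show ?thesis
    unfolding cong_ideal_def by (metis right_diff_distrib)
qed (use assms(1) in \<open>simp flip: one_eq_word\<close>)

lemma cong_word_right:
  assumes "f \<approx> g" "set u \<subseteq> alphabet G"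
  shows "f * single (Word u) 1 \<approx> g * single (Word u) 1"
proof (cases "u = []")
  case False
  from lpa_ideal.right[OF _ word_in_free_ring[OF this assms(2)]] assms(1) show ?thesis
    unfolding cong_ideal_def by (metis left_diff_distrib)
qed (use assms(1) in \<open>simp flip: one_eq_word\<close>)

lemma mon_mult_cong:
  assumes "f \<approx> g"
  shows "mon p * f * mon q \<approx> mon p * g * mon q"
proof (cases "set p \<subseteq> alphabet G \<and> set q \<subseteq> alphabet G")
  case True
  then show ?thesis
    using cong_word_right[OF cong_word_left[OF assms(1)], of p q] by (simp add: mon_def)
qed (auto simp: mon_def)

lemma mon_cong: "mon u \<approx> mon w \<Longrightarrow> mon (p @ u @ q) \<approx> mon (p @ w @ q)"
  using mon_mult_cong[of "mon u" "mon w" p q] by (simp add: mon_mult)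

lemma relation_cong: "f - g \<in> lpa_relations G \<Longrightarrow> f \<approx> g"
  unfolding cong_ideal_def by (rule lpa_ideal.rel)

lemma cong_src: "x \<in> alphabet G \<Longrightarrow> mon [Vert (letter_src G x), x] \<approx> mon [x]"
  using relation_cong[OF lpa_relations.vert] relation_cong[OF lpa_relations.edge_src] relation_cong[OF lpa_relations.ghost_src]
  by (cases x)
    (force simp: vertex_elem_eq edge_elem_eq ghost_elem_eq src_in_verts tgt_in_verts mon_mult)+

lemma cong_tgt: "x \<in> alphabet G \<Longrightarrow> mon [x, Vert (letter_tgt G x)] \<approx> mon [x]"
  using relation_cong[OF lpa_relations.vert] relation_cong[OF lpa_relations.edge_tgt] relation_cong[OF lpa_relations.ghost_tgt]
  by (cases x)
    (force simp: vertex_elem_eq edge_elem_eq ghost_elem_eq src_in_verts tgt_in_verts mon_mult)+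

lemma cong_remove_src: "x \<in> alphabet G \<Longrightarrow> mon (p @ Vert (letter_src G x) # x # q) \<approx> mon (p @ x # q)"
  using mon_cong[OF cong_src, of x p q] by simp

lemma cong_remove_tgt: "x \<in> alphabet G \<Longrightarrow> mon (p @ x # Vert (letter_tgt G x) # q) \<approx> mon (p @ x # q)"
  using mon_cong[OF cong_tgt, of x p q] by simp

lemma cong_remove_last_Vert:
  assumes "set p \<subseteq> alphabet G" "p \<noteq> []" "letter_tgt G (last p) = v"
  shows "mon (p @ [Vert v]) \<approx> mon p"
proof -
  obtain q y where "p = q @ [y]" using assms(2) by (cases p rule: rev_cases) auto
  then show ?thesis using cong_remove_tgt[of y q "[]"] assms by auto
qed

text \<open>The target of \<open>y\<close> and the source of \<open>x\<close> can be inserted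
  between the two letters, and distinct vertices multiply to zero.\<close>

lemma cong_mismatch:
  assumes "x \<in> alphabet G" "y \<in> alphabet G" "letter_tgt G y \<noteq> letter_src G x"
  shows "mon (p @ [y, x]) \<approx> 0"
proof -
  let ?u = "letter_tgt G y" and ?v = "letter_src G x"
  have uv: "?u \<in> verts G" "?v \<in> verts G" using assms letter_tgt_in_verts letter_src_in_verts by auto
  have "mon (p @ [y, x]) \<approx> mon (p @ [y, Vert ?u, x])"
    using cong_sym[OF cong_remove_tgt[OF assms(2), of p "[x]"]] .
  also have "\<dots> \<approx> mon (p @ [y, Vert ?u, Vert ?v, x])"
    using cong_sym[OF cong_remove_src[OF assms(1), of "p @ [y, Vert ?u]" "[]"]] by simp
  also have "mon [Vert ?u, Vert ?v] \<approx> 0"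
    using relation_cong[OF lpa_relations.vert[OF uv]] assms(3) uv by (simp add: vertex_elem_eq mon_mult)
  then have "mon (p @ [y, Vert ?u, Vert ?v, x]) \<approx> 0"
    using mon_mult_cong[of "mon [Vert ?u, Vert ?v]" 0 "p @ [y]" "[x]"] by (simp add: mon_mult)
  finally show ?thesis .
qed

text \<open>The relation \<open>edge_ghost\<close> at the source of \<alpha>, solved for the summand
  of the special edge.\<close>

lemma edge_ghost_cong:
  assumes "special \<alpha>" "i \<in> {1..weight G \<alpha>}" "j \<in> {1..weight G \<alpha>}"
  shows "mon [Edge \<alpha> i, Ghost \<alpha> j] \<approx>
    (if i = j then mon [Vert (src G \<alpha>)] else 0) - (\<Sum>\<gamma>\<in>out_sedges G (src G \<alpha>) - {\<alpha>}. mon [Edge \<gamma> i, Ghost \<gamma> j])"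
proof -
  let ?v = "src G \<alpha>"
  have \<alpha>: "\<alpha> \<in> sedges G" using assms(1) by (simp add: special_def)
  then have v: "?v \<in> verts G" "\<not> sink G ?v" "\<alpha> \<in> out_sedges G ?v"
    using src_in_verts not_sink_iff by (auto simp: out_sedges_def)
  have ij: "i \<in> {1..vweight G ?v}" "j \<in> {1..vweight G ?v}" using assms special_weight by auto
  have "(\<Sum>\<gamma>\<in>out_sedges G ?v. mon [Edge \<gamma> i, Ghost \<gamma> j]) = (\<Sum>\<gamma>\<in>out_sedges G ?v. edge_elem G \<gamma> i * ghost_elem G \<gamma> j)"
    by (rule sum.cong) (auto simp: edge_elem_eq ghost_elem_eq mon_mult out_sedges_def)
  also have "\<dots> \<approx> (if i = j then mon [Vert ?v] else 0)"
    using relation_cong[OF lpa_relations.edge_ghost[OF v(1,2) ij]] v(1)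
    by (cases "i = j") (simp_all add: vertex_elem_eq)
  finally have "mon [Edge \<alpha> i, Ghost \<alpha> j] + (\<Sum>\<gamma>\<in>out_sedges G ?v - {\<alpha>}. mon [Edge \<gamma> i, Ghost \<gamma> j]) \<approx> (if i = j then mon [Vert ?v] else 0)"
    by (simp add: sum.remove[OF finite_out v(3)])
  from cong_diff[OF this cong_refl[of "\<Sum>\<gamma>\<in>out_sedges G ?v - {\<alpha>}. mon [Edge \<gamma> i, Ghost \<gamma> j]"]]
  show ?thesis by simp
qed

text \<open>The relation \<open>ghost_edge\<close>, solved for the summand with index 1. Terms with
  an index above the weight of \<alpha> are zero, so the sum stops there.\<close>

lemma ghost_edge_cong:
  assumes "\<alpha> \<in> sedges G" "\<beta> \<in> sedges G"
  shows "mon [Ghost \<alpha> 1, Edge \<beta> 1] \<approx>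
    (if \<alpha> = \<beta> then mon [Vert (tgt G \<alpha>)] else 0) - (\<Sum>k\<in>{2..weight G \<alpha>}. mon [Ghost \<alpha> k, Edge \<beta> k])"
proof -
  let ?m = "max (weight G \<alpha>) (weight G \<beta>)"
  have "1 \<le> ?m" using weight_pos[OF assms(1)] by simp
  then have m: "{1..?m} = insert 1 {2..?m}" by auto
  have "(\<Sum>k\<in>{2..?m}. mon [Ghost \<alpha> k, Edge \<beta> k]) = (\<Sum>k\<in>{2..weight G \<alpha>}. mon [Ghost \<alpha> k, Edge \<beta> k])"
    by (intro sum.mono_neutral_right) (auto simp: mon_def)
  then have "mon [Ghost \<alpha> 1, Edge \<beta> 1] + (\<Sum>k\<in>{2..weight G \<alpha>}. mon [Ghost \<alpha> k, Edge \<beta> k])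
      = (\<Sum>k\<in>{1..?m}. mon [Ghost \<alpha> k, Edge \<beta> k])"
    unfolding m by (subst sum.insert) auto
  also have "\<dots> = (\<Sum>k\<in>{1..?m}. ghost_elem G \<alpha> k * edge_elem G \<beta> k)"
    by (rule sum.cong) (auto simp: edge_elem_eq ghost_elem_eq mon_mult assms)
  also have "\<dots> \<approx> (if \<alpha> = \<beta> then mon [Vert (tgt G \<alpha>)] else 0)"
    using relation_cong[OF lpa_relations.ghost_edge[OF assms]] tgt_in_verts[OF assms(1)]
    by (cases "\<alpha> = \<beta>") (simp_all add: vertex_elem_eq)
  finally have "mon [Ghost \<alpha> 1, Edge \<beta> 1] + (\<Sum>k\<in>{2..weight G \<alpha>}. mon [Ghost \<alpha> k, Edge \<beta> k])
    \<approx> (if \<alpha> = \<beta> then mon [Vert (tgt G \<alpha>)] else 0)" .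
  from cong_diff[OF this cong_refl[of "\<Sum>k\<in>{2..weight G \<alpha>}. mon [Ghost \<alpha> k, Edge \<beta> k]"]]
  show ?thesis by simp
qed

text \<open>The action only uses consequences of the relations: mismatched letters multiply to zero,
  a vertex at the end is absorbed, a linked letter is appended, and a redex is replaced according to
  the solved relations.\<close>

lemma mon_snoc_cong_act:
  assumes w: "based_normal w" and x: "x \<in> alphabet G"
  shows "mon (w @ [x]) \<approx> act x w"
proof -
  have w_ne: "w \<noteq> []" and w_al: "set w \<subseteq> alphabet G" using w based_normal_alphabet by auto
  obtain p y where w_eq: "w = p @ [y]" using w_ne by (cases w rule: rev_cases) auto
  consider "letter_tgt G y \<noteq> letter_src G x" | v where "x = Vert v" "letter_tgt G y = v"
    | "x \<notin> range Vert" "linked y x" | "redex y x" "letter_tgt G y = letter_src G x"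
    by (cases x) (auto simp: linked_def)
  then show ?thesis
  proof cases
    case 1
    then show ?thesis using cong_mismatch[OF x, of y p] w_al w_ne by (simp add: w_eq act_mismatch)
  next
    case 2
    then show ?thesis
      using cong_remove_last_Vert[OF w_al w_ne] act_Vert[OF w_al w_ne] by (simp add: w_eq)
  next
    case 3
    then show ?thesis using act_linked[OF w_al w_ne] by (simp add: w_eq)
  next
    case 4
    then have p: "p \<noteq> []" using w by (cases p) (auto elim: redex_cases simp: w_eq)
    then have p': "based_normal p" "linked (last p) y" using w by (auto simp: w_eq based_normal_append)
    \<comment> \<open>Rewriting may leave a vertex letter behind; it is absorbed because
      \<open>p\<close> ends at this vertex.\<close>
    have cut: "mon (p @ [Vert (letter_src G y)]) \<approx> mon p"
      using p' p based_normal_alphabet by (intro cong_remove_last_Vert) (auto simp: linked_def)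
    have left: "mon p * f \<approx> mon p * g" if "f \<approx> g" for f g
      using mon_mult_cong[OF that, of p "[]"] by (simp add: mon_def[of "[]"] flip: one_eq_word)
    from 4(1) show ?thesis
    proof (cases rule: redex_cases)
      case (1 \<alpha> i j)
      have idx: "i \<in> {1..weight G \<alpha>}" "j \<in> {1..weight G \<alpha>}" using w_al x by (auto simp: w_eq 1)
      have "mon (w @ [x]) \<approx> (if i = j then mon (p @ [Vert (src G \<alpha>)]) else 0)
          - (\<Sum>\<gamma>\<in>out_sedges G (src G \<alpha>) - {\<alpha>}. mon (p @ [Edge \<gamma> i, Ghost \<gamma> j]))"
        using left[OF edge_ghost_cong[OF 1(3) idx]]
        by (auto simp: w_eq 1 right_diff_distrib sum_distrib_left mon_mult)
      also have "\<dots> \<approx> (if i = j then mon p else 0)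
          - (\<Sum>\<gamma>\<in>out_sedges G (src G \<alpha>) - {\<alpha>}. mon (p @ [Edge \<gamma> i, Ghost \<gamma> j]))"
        using cut 1 by (intro cong_diff) auto
      also have "\<dots> = act x w"
        using act_edge_ghost[OF _ 1(3) idx(2)] w by (simp add: w_eq 1)
      finally show ?thesis .
    next
      case (2 \<alpha> \<beta>)
      have \<alpha>\<beta>: "\<alpha> \<in> sedges G" "\<beta> \<in> sedges G" "src G \<alpha> = src G \<beta>" using w_al x 4(2) by (auto simp: w_eq 2)
      have "mon (w @ [x]) \<approx> (if \<alpha> = \<beta> then mon (p @ [Vert (tgt G \<alpha>)]) else 0)
          - (\<Sum>k\<in>{2..weight G \<alpha>}. mon (p @ [Ghost \<alpha> k, Edge \<beta> k]))"
        using left[OF ghost_edge_cong[OF \<alpha>\<beta>(1,2)]]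
        by (auto simp: w_eq 2 right_diff_distrib sum_distrib_left mon_mult)
      also have "\<dots> \<approx> (if \<alpha> = \<beta> then mon p else 0)
          - (\<Sum>k\<in>{2..weight G \<alpha>}. mon (p @ [Ghost \<alpha> k, Edge \<beta> k]))"
        using cut 2 by (intro cong_diff) auto
      also have "\<dots> = act x w"
        using act_ghost_edge[OF _ \<alpha>\<beta>(2,3)] w by (simp add: w_eq 2)
      finally show ?thesis .
    qed
  qed
qed

lemma mon_snoc_cong_act':
  assumes "w = [] \<or> based_normal w" "x \<in> alphabet G"
  shows "mon (w @ [x]) \<approx> act x w"
proof (cases "w = []")
  case True
  have "mon [x] \<approx> mon ([Vert (letter_src G x)] @ [x])"
    using cong_sym[OF cong_src[OF assms(2)]] by simp
  also have "\<dots> \<approx> act x [Vert (letter_src G x)]"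
    using assms(2) letter_src_in_verts by (intro mon_snoc_cong_act) auto
  finally show ?thesis by (simp add: True act_Nil)
qed (use assms mon_snoc_cong_act in auto)

text \<open>Induction from the right: the last letter is appended to every word in the expansion of
  the prefix, where \<open>mon_snoc_cong_act'\<close> applies.\<close>

lemma mon_cong_lact: "set w \<subseteq> alphabet G \<Longrightarrow> mon w \<approx> lact w 1"
proof (induction w rule: rev_induct)
  case Nil
  then show ?case by (simp add: mon_def one_eq_word)
next
  case (snoc x w)
  then have x: "x \<in> alphabet G" by simp
  have "mon (w @ [x]) = mon w * single (Word [x]) 1"
    using x by (simp add: mon_def mult_single plus_free_word_def)
  also have "\<dots> \<approx> lact w 1 * single (Word [x]) 1"
    using snoc x by (intro cong_word_right) auto
  also have "\<dots> = lin (\<lambda>u. single (Word (u @ [x])) 1) (lact w 1)"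
    by (rule mult_word_lin)
  also have "\<dots> \<approx> lin (act x) (lact w 1)"
  proof (rule cong_lin)
    fix u assume "u \<in> keys (lact w 1)"
    then have u: "letters u = [] \<or> based_normal (letters u)"
      using admissible_lact[OF admissible_one] by (auto simp: admissible_def)
    then have "set (letters u @ [x]) \<subseteq> alphabet G" using x based_normal_alphabet by auto
    then show "single (Word (letters u @ [x])) 1 \<approx> act x (letters u)"
      using mon_snoc_cong_act'[OF u x] by (simp add: mon_def)
  qed
  finally show ?case by (simp add: lact_append)
qed

lemma cong_nf:
  assumes "f \<in> free_ring G"
  shows "f \<approx> nf f"
proof -
  have "lin (\<lambda>w. single (Word w) 1) f \<approx> lin (\<lambda>w. lact w 1) f"
  proof (rule cong_lin)
    fix w assume "w \<in> keys f"
    then have "set (letters w) \<subseteq> alphabet G" using assms by (auto simp: free_ring_def)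
    then show "single (Word (letters w)) 1 \<approx> lact (letters w) 1"
      using mon_cong_lact[of "letters w"] by (simp add: mon_def)
  qed
  then show ?thesis by (simp add: nf_def)
qed

text \<open>Words in the free ring are nonempty, so at least one letter acts and the empty word
  cannot survive.\<close>

lemma keys_nf:
  assumes "f \<in> free_ring G" "w \<in> keys (nf f)"
  shows "based_normal (letters w)"
proof -
  obtain u where u: "u \<in> keys f" "w \<in> keys (lact (letters u) 1)"
    using assms(2) keys_lin[of "\<lambda>w. lact w 1" f] by (auto simp: nf_def)
  then have "letters u \<noteq> []" using assms(1) by (auto simp: free_ring_def)
  then obtain p x where p: "letters u = p @ [x]" by (cases "letters u" rule: rev_cases) auto
  then obtain t where t: "t \<in> keys (lact p 1)" "w \<in> keys (act x (letters t))"
    using u keys_lin[of "act x" "lact p 1"] by (auto simp: lact_append)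
  then have "letters t = [] \<or> based_normal (letters t)"
    using admissible_lact[OF admissible_one] by (auto simp: admissible_def)
  then show ?thesis using act_keys_admissible(1)[of "letters t" "letters w" x] t by simp
qed

section \<open>Based normal words and normal generalised paths\<close>

lemma based_normal_Cons_Cons:
  assumes "based_normal (b # x # l)"
  shows "b = Vert (letter_src G x)" "x \<in> edge_letters G" "set l \<subseteq> edge_letters G" "successively linked (x # l)"
  using assms by (auto simp: based_normal_def linked_def)

lemma strip_base_cong:
  assumes "based_normal w"
  shows "mon w \<approx> mon (strip_base w)"
  using assms
proof (cases w rule: strip_base.cases)
  case (1 v x l)
  then show ?thesis
    using based_normal_Cons_Cons[of v x l] assms cong_remove_src[of x "[]" l] edge_letters_alphabet by auto
qed auto

text \<open>Reading a normal word letter by letter never meets a redex, so every letter is simply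
  appended.\<close>

lemma lact_based_normal: "p \<noteq> [] \<Longrightarrow> based_normal (p @ l) \<Longrightarrow> lact l (mon p) = mon (p @ l)"
proof (induction l arbitrary: p)
  case (Cons x l)
  then have "lin (act x) (mon p) = mon (p @ [x])"
    by (intro lin_act_linked) (auto simp: based_normal_append)
  then show ?case using Cons.IH[of "p @ [x]"] Cons.prems by simp
qed simp

lemma lact_one_Cons: "lact (x # l) 1 = lact (x # l) (single (Word [Vert (letter_src G x)]) 1)"
  by (simp add: one_eq_word act_Nil)

text \<open>Acting on the empty word restores the base vertex as the source of the first letter, so
  \<open>nf\<close> inverts \<open>strip_base\<close>. Uniqueness of normal forms and injectivity of
  \<open>strip_base\<close> rest on this.\<close>

lemma nf_strip_base:
  assumes "based_normal w"
  shows "nf (single (Word (strip_base w)) 1) = single (Word w) 1"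
  using assms
proof (cases w rule: strip_base.cases)
  case (1 v x l)
  note bn = based_normal_Cons_Cons[of v x l]
  have v: "v = Vert (letter_src G x)" "based_normal [v]"
    using bn assms letter_src_in_verts[of x] edge_letters_alphabet unfolding 1 by auto
  have "nf (single (Word (strip_base w)) 1) = lact (x # l) (mon [v])"
    using v by (simp only: 1 strip_base.simps nf_word lact_one_Cons mon_based_normal)
  also have "\<dots> = single (Word w) 1"
    using lact_based_normal[of "[v]" "x # l"] assms by (simp add: 1 mon_based_normal)
  finally show ?thesis .
next
  case ("2_2" b)
  then obtain v where "b = Vert v" "v \<in> verts G" using assms by auto
  then show ?thesis using "2_2" assms act_Vert[of "[Vert v]" v]
    by (simp add: nf_word one_eq_word act_Nil mon_based_normal)
qed (use assms in auto)

text \<open>A special edge is \<open>sp v\<close> for the non-sink \<open>v\<close> at which it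
  starts, and conversely. Over the edge letters, the redexes are thus exactly the two-letter words
  forbidden in \<open>normal_path\<close>.\<close>

lemma redex_free_iff:
  assumes "set p \<subseteq> edge_letters G"
  shows "successively (\<lambda>x y. \<not> redex x y) p \<longleftrightarrow>
     (\<forall>v \<in> verts G. \<not> sink G v \<longrightarrow>
        (\<forall>i \<in> {1..weight G (sp v)}. \<forall>j \<in> {1..weight G (sp v)}.
           \<not> sublist [Edge (sp v) i, Ghost (sp v) j] p)) \<and>
     (\<forall>\<alpha> \<in> sedges G. \<forall>\<beta> \<in> sedges G. \<not> sublist [Ghost \<alpha> 1, Edge \<beta> 1] p)" (is "?L \<longleftrightarrow> ?R")
proof
  assume L: ?L
  have "redex (Edge (sp v) i) (Ghost (sp v) j)" if "v \<in> verts G" "\<not> sink G v" for v i j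
    using sp_props(4)[OF that] by simp
  moreover have "redex (Ghost \<alpha> 1) (Edge \<beta> 1)" for \<alpha> \<beta> by simp
  ultimately show ?R using L unfolding successively_iff_sublist by blast
next
  assume R: ?R
  show ?L unfolding successively_iff_sublist
  proof (intro allI impI notI)
    fix y x assume sub: "sublist [y, x] p" and "redex y x"
    have yx: "y \<in> edge_letters G" "x \<in> edge_letters G" using set_mono_sublist[OF sub] assms by auto
    from \<open>redex y x\<close> show False
    proof (cases rule: redex_cases)
      case (1 \<alpha> i j)
      have "\<alpha> = sp (src G \<alpha>)" "src G \<alpha> \<in> verts G" "\<not> sink G (src G \<alpha>)"
        using 1(3) src_in_verts not_sink_iff by (auto simp: special_def)
      then show False using R sub yx 1 by (metis in_edge_letters(1,2))
    next
      case (2 \<alpha> \<beta>)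
      then show False using R sub yx by auto
    qed
  qed
qed

lemma successively_linked:
  "successively linked p \<longleftrightarrow>
    successively (\<lambda>x y. letter_tgt G x = letter_src G y) p \<and> successively (\<lambda>x y. \<not> redex x y) p"
  by (induction p rule: induct_list012) (auto simp: linked_def)

lemma normal_path_edges_iff:
  assumes "set p \<subseteq> edge_letters G" "p \<noteq> []"
  shows "normal_path G sp p \<longleftrightarrow> successively linked p"
  using assms redex_free_iff[OF assms(1)] unfolding normal_path_def gen_path_def successively_linked by auto

lemma normal_path_strip_base:
  assumes "based_normal w"
  shows "normal_path G sp (strip_base w)"
  using assms
proof (cases w rule: strip_base.cases)
  case (1 v x l)
  then show ?thesis
    using based_normal_Cons_Cons[of v x l] assms by (simp add: normal_path_edges_iff)
next
  case ("2_2" b)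
  then show ?thesis using assms by (auto simp: normal_path_def gen_path_def sublist_Cons_right)
qed (use assms in auto)

lemma normal_path_obtain_base:
  assumes "normal_path G sp p"
  obtains w where "based_normal w" "strip_base w = p"
proof (cases "\<exists>v\<in>verts G. p = [Vert v]")
  case True
  then show ?thesis using that[of p] by auto
next
  case False
  then have p: "set p \<subseteq> edge_letters G" "p \<noteq> []" using assms by (auto simp: normal_path_def gen_path_def)
  then have "successively linked p" using assms normal_path_edges_iff by simp
  then have "based_normal (Vert (letter_src G (hd p)) # p)"
    using p letter_src_in_verts[of "hd p"] edge_letters_alphabet
    by (cases p) (auto simp: based_normal_def linked_def)
  moreover have "strip_base (Vert (letter_src G (hd p)) # p) = p" using p by (cases p) auto
  ultimately show ?thesis by (rule that)
qed

definition strip :: "('v, 'e, 'r) free_elem \<Rightarrow> ('v, 'e, 'r) free_elem" where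
  "strip m = lin (\<lambda>w. single (Word (strip_base w)) 1) m"

lemma normal_path_alphabet: "normal_path G sp p \<Longrightarrow> p \<noteq> [] \<and> set p \<subseteq> alphabet G"
  by (auto simp: normal_path_def gen_path_def alphabet_def)

text \<open>Existence: \<open>f\<close>, \<open>nf f\<close> and \<open>strip (nf f)\<close> are
  congruent, and the last is normal. Uniqueness: \<open>nf\<close> vanishes on the ideal, so a
  normal \<open>g\<close> in the class has \<open>nf g = nf f\<close>, and
  \<open>strip (nf g) = g\<close> because \<open>nf\<close> only adds base vertices to normal
  paths.\<close>

lemma NF_class:
  assumes f: "f \<in> free_ring G"
  shows "NF G sp (lpa_class G f) = strip (nf f)"
  unfolding NF_def
proof (rule the_equality)
  have keys: "normal_path G sp (letters w)" if w: "w \<in> keys (strip (nf f))" for w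
  proof -
    obtain u where u: "u \<in> keys (nf f)" "w \<in> keys (single (Word (strip_base (letters u))) (1::'r))"
      using w keys_lin[of "\<lambda>w. single (Word (strip_base w)) (1::'r)" "nf f"] unfolding strip_def by fast
    then show ?thesis using normal_path_strip_base[OF keys_nf[OF f u(1)]] by simp
  qed
  have "f \<approx> nf f" by (rule cong_nf[OF f])
  also have "nf f = lin (\<lambda>w. single (Word w) 1) (nf f)" by simp
  also have "\<dots> \<approx> strip (nf f)"
    unfolding strip_def
  proof (rule cong_lin)
    fix w assume "w \<in> keys (nf f)"
    then have w: "based_normal (letters w)" by (rule keys_nf[OF f])
    then show "single (Word (letters w)) 1 \<approx> single (Word (strip_base (letters w))) 1"
      using strip_base_cong[OF w] normal_path_alphabet[OF normal_path_strip_base[OF w]]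
      by (simp add: mon_based_normal mon_def[of "strip_base _"])
  qed
  finally have "strip (nf f) - f \<in> lpa_ideal G"
    using cong_sym unfolding cong_ideal_def by blast
  moreover have "strip (nf f) \<in> free_ring G"
    using keys normal_path_alphabet by (auto simp: free_ring_def)
  ultimately show "strip (nf f) \<in> lpa_class G f \<and> (\<forall>w\<in>keys (strip (nf f)). normal_path G sp (letters w))"
    using keys by (simp add: lpa_class_def)
next
  fix g assume g: "g \<in> lpa_class G f \<and> (\<forall>w\<in>keys g. normal_path G sp (letters w))"
  then have "nf (g - f) = 0" by (intro nf_ideal) (simp add: lpa_class_def)
  then have "strip (nf f) = strip (nf g)" by (simp add: nf_diff)
  also have "\<dots> = lin (\<lambda>w. strip (lact w 1)) g" by (simp add: strip_def nf_def lin_lin)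
  also have "\<dots> = lin (\<lambda>w. single (Word w) 1) g"
  proof (rule lin_cong)
    fix w assume "w \<in> keys g"
    then obtain u where u: "based_normal u" "strip_base u = letters w"
      using g normal_path_obtain_base by metis
    then show "strip (lact (letters w) 1) = single (Word (letters w)) 1"
      using nf_strip_base[OF u(1), unfolded nf_word] by (simp add: strip_def)
  qed
  finally show "g = strip (nf f)" by simp
qed

end

section \<open>Products of normal paths\<close>

text \<open>Renaming words injectively merges no two of them, so no coefficients cancel.\<close>

lemma keys_lin_inj:
  assumes "inj_on h (letters ` keys m)"
  shows "keys (lin (\<lambda>w. single (Word (h w)) (1::'r::ring_1)) m) = (\<lambda>w. Word (h (letters w))) ` keys m"
proof -
  have "lookup (lin (\<lambda>w. single (Word (h w)) (1::'r)) m) (Word (h (letters w))) = lookup m w" if "w \<in> keys m" for w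
  proof -
    have "u = w" if "u \<in> keys m" "h (letters u) = h (letters w)" for u
      using assms that \<open>w \<in> keys m\<close> by (metis free_word.expand imageI inj_onD)
    then have "lookup (lin (\<lambda>w. single (Word (h w)) (1::'r)) m) (Word (h (letters w)))
        = (\<Sum>u\<in>keys m. if u = w then lookup m w else 0)"
      unfolding lookup_lin by (intro sum.cong) (auto simp: lookup_single when_def)
    then show ?thesis using that by simp
  qed
  then have "(\<lambda>w. Word (h (letters w))) ` keys m \<subseteq> keys (lin (\<lambda>w. single (Word (h w)) (1::'r)) m)"
    by (auto simp: in_keys_iff)
  then show ?thesis using keys_lin[of "\<lambda>w. single (Word (h w)) (1::'r)" m] by auto
qed

lemma append_eq_split:
  assumes "xs @ [a, b] @ ys = u @ l" "length u = Suc (length xs)"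
  shows "u = xs @ [a]" "l = b # ys"
  using append_eq_append_conv[of "xs @ [a]" u "b # ys" l] assms by auto

lemma append_eq_split2:
  assumes "xs @ [a, b] @ ys = xs' @ [a', b'] @ ys'" "length xs = length xs'"
  shows "xs = xs' \<and> a = a' \<and> b = b' \<and> ys = ys'"
  using assms by simp

context weighted_graph_choice
begin

section \<open>The part of top degree in a product of two normal paths\<close>

lemma lact_diff: "lact w (f - g) = lact w f - lact w g"
  by (induction w arbitrary: f g) (auto simp: lin_diff)

lemma lact_sum: "lact w (\<Sum>a\<in>A. h a) = (\<Sum>a\<in>A. lact w (h a))"
  by (induction w arbitrary: h) (auto simp: lin_sum)

text \<open>Each letter keeps the base and lengthens a word by at most one.\<close>

lemma lact_keys_bound:
  assumes "\<And>u. u \<in> keys m \<Longrightarrow> based_normal (letters u) \<and> length (letters u) \<le> n \<and> hd (letters u) = b"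
    and "w \<in> keys (lact l m)"
  shows "based_normal (letters w) \<and> length (letters w) \<le> n + length l \<and> hd (letters w) = b"
  using assms
proof (induction l arbitrary: m n)
  case (Cons x l)
  have "based_normal (letters w) \<and> length (letters w) \<le> Suc n + length l \<and> hd (letters w) = b"
  proof (rule Cons.IH)
    fix u assume "u \<in> keys (lin (act x) m)"
    then obtain t where t: "t \<in> keys m" "u \<in> keys (act x (letters t))" using keys_lin by blast
    then show "based_normal (letters u) \<and> length (letters u) \<le> Suc n \<and> hd (letters u) = b"
      using Cons.prems(1)[OF t(1)] act_keys_admissible[of "letters t" "letters u" x]
      by (auto split: if_splits)
  qed (use Cons.prems in simp)
  then show ?case by simp
qed simp

lemma lookup_lact_eq_0:
  assumes "based_normal p" "length p + length l < length t"
  shows "lookup (lact l (mon p)) (Word t) = 0"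
proof (rule ccontr)
  assume "\<not> ?thesis"
  then have "Word t \<in> keys (lact l (mon p))" by (simp add: in_keys_iff)
  from lact_keys_bound[OF _ this, of "length p" "hd p"] assms show False
    by (simp add: mon_based_normal)
qed

lemma linked_replace_ghost: "linked (Ghost \<alpha> j) z \<Longrightarrow> src G \<gamma> = src G \<alpha> \<Longrightarrow> linked (Ghost \<gamma> j) z"
  by (cases z) (auto simp: linked_def)

lemma linked_Edge_index: "linked (Edge \<beta> i) z \<Longrightarrow> linked (Edge \<beta> k) z"
  by (cases z) (auto simp: linked_def)

lemma based_normal_ConsD:
  assumes "based_normal (b # x # l)"
  shows "set l \<subseteq> edge_letters G" "successively linked l" "l = [] \<or> linked x (hd l)"
  using assms by (auto simp: based_normal_def successively_Cons)

text \<open>After the rewriting step at the junction, the new ghost letter has the same index as the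
  old one and is therefore still linked with \<open>l\<close>, which is appended unchanged. Only the
  short term \<open>p\<close> may be rewritten further.\<close>

lemma lact_edge_ghost:
  assumes p: "based_normal (p @ [Edge \<alpha> i])" and \<alpha>: "special \<alpha>"
    and l: "based_normal (b # Ghost \<alpha> j # l)"
  shows "lact (Ghost \<alpha> j # l) (mon (p @ [Edge \<alpha> i])) = (if i = j then lact l (mon p) else 0)
    - (\<Sum>\<gamma>\<in>out_sedges G (src G \<alpha>) - {\<alpha>}. mon (p @ [Edge \<gamma> i, Ghost \<gamma> j] @ l))"
proof -
  have ij: "i \<in> {1..weight G \<alpha>}" "j \<in> {1..weight G \<alpha>}"
    using based_normal_alphabet[OF p] based_normal_alphabet[OF l] by auto
  have "lact l (mon (p @ [Edge \<gamma> i, Ghost \<gamma> j])) = mon (p @ [Edge \<gamma> i, Ghost \<gamma> j] @ l)"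
    if \<gamma>: "\<gamma> \<in> out_sedges G (src G \<alpha>) - {\<alpha>}" for \<gamma>
  proof (cases "i \<in> {1..weight G \<gamma>} \<and> j \<in> {1..weight G \<gamma>}")
    case True
    have "based_normal ((p @ [Edge \<gamma> i, Ghost \<gamma> j]) @ l)"
      using based_normal_rewrite_edge_ghost[OF p \<alpha> \<gamma>] True based_normal_ConsD[OF l] \<gamma>
        linked_replace_ghost[of \<alpha> j "hd l" \<gamma>]
      by (subst based_normal_append) (auto simp: out_sedges_def)
    then show ?thesis using lact_based_normal[of "p @ [Edge \<gamma> i, Ghost \<gamma> j]" l] by simp
  qed (auto simp: mon_def)
  then show ?thesis
    by (simp add: lin_act_edge_ghost[OF \<alpha> ij] lact_diff lact_sum)
qed

text \<open>As for the other rule: whether an edge letter that is not preceded by anything new is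
  linked with \<open>l\<close> does not depend on its index, so only the short term \<open>p\<close>
  may be rewritten further.\<close>

lemma lact_ghost_edge:
  assumes p: "based_normal (p @ [Ghost \<alpha> 1])" and src: "src G \<beta> = src G \<alpha>"
    and l: "based_normal (b # Edge \<beta> 1 # l)"
  shows "lact (Edge \<beta> 1 # l) (mon (p @ [Ghost \<alpha> 1])) = (if \<alpha> = \<beta> then lact l (mon p) else 0)
    - (\<Sum>k\<in>{2..weight G \<alpha>}. mon (p @ [Ghost \<alpha> k, Edge \<beta> k] @ l))"
proof -
  have \<alpha>\<beta>: "\<alpha> \<in> sedges G" "\<beta> \<in> sedges G"
    using based_normal_alphabet[OF p] based_normal_alphabet[OF l] by auto
  have "lact l (mon (p @ [Ghost \<alpha> k, Edge \<beta> k])) = mon (p @ [Ghost \<alpha> k, Edge \<beta> k] @ l)"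
    if k: "k \<in> {2..weight G \<alpha>}" for k
  proof (cases "k \<le> weight G \<beta>")
    case True
    have "based_normal ((p @ [Ghost \<alpha> k, Edge \<beta> k]) @ l)"
      using based_normal_rewrite_ghost_edge[OF p \<alpha>\<beta>(2) src k True] based_normal_ConsD[OF l]
        linked_Edge_index[of \<beta> 1 "hd l" k]
      by (subst based_normal_append) auto
    then show ?thesis using lact_based_normal[of "p @ [Ghost \<alpha> k, Edge \<beta> k]" l] by simp
  qed (auto simp: mon_def)
  then show ?thesis
    using lin_act_ghost_edge[OF \<alpha>\<beta>] src by (simp add: lact_diff lact_sum)
qed

lemma lookup_mon: "lookup (mon w) (Word t) = (if w = t \<and> set t \<subseteq> alphabet G then 1 else 0)"
  by (auto simp: mon_def lookup_single when_def)

lemma based_normal_join: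
  assumes "based_normal p" "based_normal (Vert v # l)" "letter_tgt G (last p) = v"
    and "l = [] \<or> \<not> redex (last p) (hd l)"
  shows "based_normal (p @ l)"
proof -
  have "p \<noteq> []" using assms(1) by auto
  moreover have "set l \<subseteq> edge_letters G \<and> successively linked l \<and> (l = [] \<or> letter_src G (hd l) = v)"
    using assms(2) by (cases l) (auto simp: based_normal_def linked_def)
  ultimately show ?thesis using assms by (auto simp: based_normal_append linked_def)
qed

text \<open>A word of full length arises by plain concatenation or by the one rewriting step at the
  junction, because everything that comes from the shortened term stays below this length.\<close>

lemma lookup_lact_top_cases:
  assumes p: "based_normal p" and l: "based_normal (Vert v # l)" and v: "letter_tgt G (last p) = v"
    and t: "length t = length p + length l" and nz: "lookup (lact l (mon p)) (Word t) \<noteq> 0"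
  obtains (plain) "t = p @ l" "l = [] \<or> \<not> redex (last p) (hd l)"
  | (edge_ghost) p' l' \<alpha> \<gamma> i j where "p = p' @ [Edge \<alpha> i]" "l = Ghost \<alpha> j # l'" "special \<alpha>" "\<gamma> \<noteq> \<alpha>"
      "t = p' @ [Edge \<gamma> i, Ghost \<gamma> j] @ l'"
  | (ghost_edge) p' l' \<alpha> \<beta> k where "p = p' @ [Ghost \<alpha> 1]" "l = Edge \<beta> 1 # l'" "k \<noteq> 1"
      "t = p' @ [Ghost \<alpha> k, Edge \<beta> k] @ l'"
proof (cases "l = [] \<or> \<not> redex (last p) (hd l)")
  case True
  then have "lact l (mon p) = mon (p @ l)"
    using lact_based_normal[of p l] based_normal_join[OF p l v] p by fastforce
  then show ?thesis using nz True plain by (simp add: lookup_mon split: if_splits)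
next
  case False
  then obtain p' y x l' where pl: "p = p' @ [y]" "l = x # l'"
    using p by (cases p rule: rev_cases; cases l) auto
  have "redex y x" using False by (simp add: pl)
  have "p' \<noteq> []" using p \<open>redex y x\<close> unfolding pl by (cases p') (auto elim: redex_cases)
  then have "based_normal p'" using p by (simp add: pl based_normal_append)
  \<comment> \<open>Both letters of the redex are lost in this term, so it falls short of
    \<open>t\<close> by two.\<close>
  then have short: "lookup (lact l' (mon p')) (Word t) = 0"
    using t by (intro lookup_lact_eq_0) (auto simp: pl)
  from \<open>redex y x\<close> show ?thesis
  proof (cases rule: redex_cases)
    case (1 \<alpha> i j)
    have "(\<Sum>\<gamma>\<in>out_sedges G (src G \<alpha>) - {\<alpha>}. lookup (mon (p' @ [Edge \<gamma> i, Ghost \<gamma> j] @ l')) (Word t)) \<noteq> 0"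
      using nz p l lact_edge_ghost[of p' \<alpha> i "Vert v" j l'] 1 short
      unfolding pl by (auto simp: lookup_minus lookup_sum split: if_splits)
    then obtain \<gamma> where "\<gamma> \<in> out_sedges G (src G \<alpha>) - {\<alpha>}" "lookup (mon (p' @ [Edge \<gamma> i, Ghost \<gamma> j] @ l')) (Word t) \<noteq> 0"
      by (meson sum.not_neutral_contains_not_neutral)
    then show ?thesis using edge_ghost 1 pl by (auto simp: lookup_mon split: if_splits)
  next
    case (2 \<alpha> \<beta>)
    have "src G \<beta> = src G \<alpha>" using v l by (auto simp: pl 2 based_normal_def linked_def)
    then have "(\<Sum>k\<in>{2..weight G \<alpha>}. lookup (mon (p' @ [Ghost \<alpha> k, Edge \<beta> k] @ l')) (Word t)) \<noteq> 0"
      using nz p l lact_ghost_edge[of p' \<alpha> \<beta> "Vert v" l'] 2 short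
      unfolding pl by (auto simp: lookup_minus lookup_sum split: if_splits)
    then obtain k where "k \<in> {2..weight G \<alpha>}" "lookup (mon (p' @ [Ghost \<alpha> k, Edge \<beta> k] @ l')) (Word t) \<noteq> 0"
      by (meson sum.not_neutral_contains_not_neutral)
    then show ?thesis using ghost_edge[of p' \<alpha> \<beta> l' k] 2 pl by (auto simp: lookup_mon split: if_splits)
  qed
qed

lemma lookup_lact_plain:
  assumes p: "based_normal p" and l: "based_normal (Vert v # l)" and v: "letter_tgt G (last p) = v"
    and "l = [] \<or> \<not> redex (last p) (hd l)"
  shows "lookup (lact l (mon p)) (Word (p @ l)) = 1"
proof -
  have bn: "based_normal (p @ l)" using based_normal_join[OF p l v assms(4)] .
  then have "lact l (mon p) = mon (p @ l)" using lact_based_normal[of p l] p by fastforce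
  then show ?thesis using based_normal_alphabet[OF bn] by (simp add: lookup_mon)
qed

text \<open>Equal weights keep \<open>i\<close> and \<open>j\<close> in range for \<gamma>, so the
  word really occurs. It comes from a single summand of the rewriting rule, and the shortened term
  cannot reach its length.\<close>

lemma lookup_lact_edge_ghost:
  assumes p: "based_normal (p @ [Edge \<alpha> i])" and l: "based_normal (Vert v # Ghost \<alpha> j # l)"
    and \<alpha>: "special \<alpha>" and \<gamma>: "\<gamma> \<in> out_sedges G (src G \<alpha>)" "\<gamma> \<noteq> \<alpha>" "weight G \<gamma> = weight G \<alpha>"
  shows "lookup (lact (Ghost \<alpha> j # l) (mon (p @ [Edge \<alpha> i]))) (Word (p @ [Edge \<gamma> i, Ghost \<gamma> j] @ l)) = - 1"
    (is "lookup _ (Word ?t) = _")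
proof -
  have "p \<noteq> []" using p by (cases p) auto
  then have "based_normal p" using p by (simp add: based_normal_append)
  then have short: "lookup (lact l (mon p)) (Word ?t) = 0" by (intro lookup_lact_eq_0) auto
  have "set ?t \<subseteq> alphabet G"
    using based_normal_alphabet[OF p] based_normal_alphabet[OF l] \<gamma> by (auto simp: out_sedges_def)
  then have "(\<Sum>\<delta>\<in>out_sedges G (src G \<alpha>) - {\<alpha>}. lookup (mon (p @ [Edge \<delta> i, Ghost \<delta> j] @ l)) (Word ?t))
      = (\<Sum>\<delta>\<in>out_sedges G (src G \<alpha>) - {\<alpha>}. if \<delta> = \<gamma> then 1 else 0)"
    by (intro sum.cong) (auto simp: lookup_mon)
  also have "\<dots> = 1" using \<gamma> by simp
  finally show ?thesis
    using short unfolding lact_edge_ghost[OF p \<alpha> l] by (auto simp: lookup_minus lookup_sum)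
qed

text \<open>The index \<open>k\<close> is in range for both edges, so the word really occurs, in a
  single summand; the shortened term cannot reach its length.\<close>

lemma lookup_lact_ghost_edge:
  assumes p: "based_normal (p @ [Ghost \<alpha> 1])" and l: "based_normal (Vert v # Edge \<beta> 1 # l)"
    and src: "src G \<beta> = src G \<alpha>" and k: "k \<in> {2..weight G \<alpha>}" "k \<le> weight G \<beta>"
  shows "lookup (lact (Edge \<beta> 1 # l) (mon (p @ [Ghost \<alpha> 1]))) (Word (p @ [Ghost \<alpha> k, Edge \<beta> k] @ l)) = - 1"
    (is "lookup _ (Word ?t) = _")
proof -
  have "p \<noteq> []" using p by (cases p) auto
  then have "based_normal p" using p by (simp add: based_normal_append)
  then have short: "lookup (lact l (mon p)) (Word ?t) = 0" by (intro lookup_lact_eq_0) auto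
  have "set ?t \<subseteq> alphabet G"
    using based_normal_alphabet[OF p] based_normal_alphabet[OF l] k by auto
  then have "(\<Sum>i\<in>{2..weight G \<alpha>}. lookup (mon (p @ [Ghost \<alpha> i, Edge \<beta> i] @ l)) (Word ?t))
      = (\<Sum>i\<in>{2..weight G \<alpha>}. if i = k then 1 else 0)"
    by (intro sum.cong) (auto simp: lookup_mon)
  also have "\<dots> = 1" using k by simp
  finally show ?thesis
    using short unfolding lact_ghost_edge[OF p src l] by (auto simp: lookup_minus lookup_sum)
qed

text \<open>The two letters created by a rewriting step are always twins.\<close>

fun twin :: "('v, 'e) letter \<Rightarrow> ('v, 'e) letter \<Rightarrow> bool" where
  "twin (Edge \<alpha> i) (Ghost \<beta> j) \<longleftrightarrow> \<alpha> = \<beta>"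
| "twin (Ghost \<alpha> i) (Edge \<beta> j) \<longleftrightarrow> i = j"
| "twin _ _ \<longleftrightarrow> False"

lemma redex_twin: "redex x y \<Longrightarrow> twin x y"
  by (auto elim: redex_cases)

lemma lact_one_based_normal:
  assumes "based_normal w"
  shows "lact w 1 = mon w"
proof -
  obtain v l where w: "w = Vert v # l" and v: "v \<in> verts G" using assms by (auto simp: based_normal_def)
  have "lin (act (Vert v)) 1 = mon [Vert v]"
    using act_Vert[of "[Vert v]" v] v by (simp add: one_eq_word act_Nil)
  then have "lact w 1 = lact l (mon [Vert v])" by (simp add: w)
  also have "\<dots> = mon w"
    using lact_based_normal[of "[Vert v]" l] assms by (simp add: w)
  finally show ?thesis .
qed

text \<open>The base vertex of a right-hand word acts as the identity on a left-hand word ending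
  there, so only the tail acts.\<close>

lemma nf_mult:
  assumes A: "\<And>u. u \<in> keys A \<Longrightarrow> based_normal (letters u) \<and> letter_tgt G (last (letters u)) = v"
    and B: "\<And>w. w \<in> keys B \<Longrightarrow> based_normal (letters w) \<and> hd (letters w) = Vert v"
  shows "nf (A * B) = (\<Sum>u\<in>keys A. \<Sum>w\<in>keys B.
    scale (lookup A u * lookup B w) (lact (tl (letters w)) (mon (letters u))))"
proof -
  have "nf (single (u + w) (lookup A u * lookup B w))
      = scale (lookup A u * lookup B w) (lact (tl (letters w)) (mon (letters u)))"
    if u: "u \<in> keys A" and w: "w \<in> keys B" for u w
  proof -
    obtain l where l: "letters w = Vert v # l" using B[OF w] by (cases "letters w") auto
    have "letters u \<noteq> []" using A[OF u] by auto
    then have "lact (letters u @ letters w) 1 = lact l (mon (letters u))"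
      using A[OF u] act_Vert[OF based_normal_alphabet, of "letters u" v]
      by (simp add: lact_append lact_one_based_normal l lin_act_based_normal)
    then show ?thesis by (simp add: nf_def plus_free_word_def l)
  qed
  then show ?thesis by (simp add: times_eq_sum_single[of A B] nf_sum)
qed

end

locale LV_graph_choice = LV_graph G + weighted_graph_choice G sp coeff
  for G :: "('v, 'e) wgraph" and sp :: "'v \<Rightarrow> 'e" and coeff :: "'r::ring_1_no_zero_divisors itself"
begin

text \<open>A special edge has maximal weight at its source, and an LV-graph has at least two such
  edges there.\<close>

lemma other_maximal_edge:
  assumes "special \<alpha>"
  obtains \<gamma> where "\<gamma> \<in> out_sedges G (src G \<alpha>)" "\<gamma> \<noteq> \<alpha>" "weight G \<gamma> = weight G \<alpha>"
proof -
  let ?M = "{\<gamma> \<in> out_sedges G (src G \<alpha>). weight G \<gamma> = vweight G (src G \<alpha>)}"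
  have \<alpha>: "\<alpha> \<in> sedges G" using assms by (simp add: special_def)
  then have "2 \<le> card ?M" using src_in_verts not_sink_iff by (intro two_maximal) auto
  then have "\<not> ?M \<subseteq> {\<alpha>}" using card_mono[of "{\<alpha>}" ?M] by auto
  then show ?thesis using that special_weight[OF assms] by auto
qed

text \<open>In the application \<open>P\<close> consists of the longest words of the left factor,
  with base, and \<open>L\<close> of those of the right factor, without base. A word that only one
  pair produces cannot be cancelled by other pairs. It is \<open>p @ l\<close> for a suitable pair
  that is not a redex, or the outcome of a rewriting step if all pairs are redexes.\<close>

lemma isolated_top_word:
  assumes P: "P \<noteq> {}" "\<And>p. p \<in> P \<Longrightarrow> based_normal p \<and> letter_tgt G (last p) = v \<and> length p = m"
    and L: "L \<noteq> {}" "\<And>l. l \<in> L \<Longrightarrow> based_normal (Vert v # l) \<and> length l = n"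
  obtains p l t where "p \<in> P" "l \<in> L" "length t = m + n" "lookup (lact l (mon p)) (Word t) \<in> {1, - 1}"
    "\<forall>p'\<in>P. \<forall>l'\<in>L. lookup (lact l' (mon p')) (Word t) \<noteq> 0 \<longrightarrow> p' = p \<and> l' = l"
proof (cases "\<exists>p\<in>P. \<exists>l\<in>L. l = [] \<or> \<not> redex (last p) (hd l)")
  case True
  \<comment> \<open>A pair that is not a twin is preferred, since rewriting only creates twins. If
    there is none, all pairs are twins, and any pair that is not a redex will do.\<close>
  have "\<exists>p\<in>P. \<exists>l\<in>L. (l = [] \<or> \<not> redex (last p) (hd l)) \<and>
    ((l = [] \<or> \<not> twin (last p) (hd l)) \<or> (\<forall>p'\<in>P. \<forall>l'\<in>L. twin (last p') (hd l')))"
  proof (cases "\<forall>p'\<in>P. \<forall>l'\<in>L. l' \<noteq> [] \<and> twin (last p') (hd l')")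
    case False
    then show ?thesis using redex_twin by blast
  qed (use True in blast)
  then obtain p l where pl: "p \<in> P" "l \<in> L" "l = [] \<or> \<not> redex (last p) (hd l)"
    and twin: "(l = [] \<or> \<not> twin (last p) (hd l)) \<or> (\<forall>p'\<in>P. \<forall>l'\<in>L. twin (last p') (hd l'))" by blast
  show ?thesis
  proof (rule that[OF pl(1,2), of "p @ l"]; (intro ballI impI)?)
    show "length (p @ l) = m + n" using P(2) L(2) pl by auto
    show "lookup (lact l (mon p)) (Word (p @ l)) \<in> {1, - 1}"
      using lookup_lact_plain[of p v l] P(2) L(2) pl by auto
    fix p' l' assume pl': "p' \<in> P" "l' \<in> L" and nz: "lookup (lact l' (mon p')) (Word (p @ l)) \<noteq> 0"
    have len: "length p' = length p" "length l' = length l" using P(2) L(2) pl pl' by auto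
    have bn: "based_normal p'" "based_normal (Vert v # l')" "letter_tgt G (last p') = v"
      using P(2) L(2) pl' by auto
    have len': "length (p @ l) = length p' + length l'" using len by simp
    show "p' = p \<and> l' = l"
    proof (cases rule: lookup_lact_top_cases[OF bn len' nz])
      case 1
      then show ?thesis using len by simp
    next
      case (2 p0 l0 \<alpha> \<gamma> i j)
      have "length p = Suc (length p0)" using len(1) 2(1) by simp
      note eq = append_eq_split[OF 2(5)[symmetric] this]
      \<comment> \<open>A rewriting step creates a twin at the junction, so all pairs are twins. But
        the last letter of \<open>p'\<close> and the created \<open>hd l\<close> belong to different
        edges, hence are not twins. The case of a ghost followed by an edge is analogous, with
        indices 1 and \<open>k\<close>.\<close>
      have "twin (last p) (hd l)" "l \<noteq> []" by (simp_all add: eq)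
      then have "twin (last p') (hd l)" using twin pl(2) pl'(1) by blast
      with 2(1,4) eq show ?thesis by simp
    next
      case (3 p0 l0 \<alpha> \<beta> k)
      have "length p = Suc (length p0)" using len(1) 3(1) by simp
      note eq = append_eq_split[OF 3(4)[symmetric] this]
      have "twin (last p) (hd l)" "l \<noteq> []" by (simp_all add: eq)
      then have "twin (last p') (hd l)" using twin pl(2) pl'(1) by blast
      with 3(1,3) eq show ?thesis by simp
    qed
  qed
next
  case False
  then have redex: "l \<noteq> [] \<and> redex (last p) (hd l)" if "p \<in> P" "l \<in> L" for p l using that by blast
  obtain p l where pl: "p \<in> P" "l \<in> L" using P(1) L(1) by blast
  have bn: "based_normal p" "based_normal (Vert v # l)" "letter_tgt G (last p) = v" and len: "length p = m" "length l = n"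
    using P(2) L(2) pl by auto
  obtain p0 y x l0 where pl0: "p = p0 @ [y]" "l = x # l0"
    using redex[OF pl] bn(1) by (cases p rule: rev_cases; cases l) auto
  have "redex y x" using redex[OF pl] by (simp add: pl0)
  then show ?thesis
  proof (cases rule: redex_cases)
    case (1 \<alpha> i j)
    \<comment> \<open>A second edge of maximal weight provides a summand of the rewriting rule for
      which both indices are in range.\<close>
    obtain \<gamma> where \<gamma>: "\<gamma> \<in> out_sedges G (src G \<alpha>)" "\<gamma> \<noteq> \<alpha>" "weight G \<gamma> = weight G \<alpha>"
      using other_maximal_edge[OF 1(3)] .
    let ?t = "p0 @ [Edge \<gamma> i, Ghost \<gamma> j] @ l0"
    show ?thesis
    proof (rule that[OF pl, of ?t]; (intro ballI impI)?)
      show len_t: "length ?t = m + n" using len by (simp add: pl0)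
      show "lookup (lact l (mon p)) (Word ?t) \<in> {1, - 1}"
        using lookup_lact_edge_ghost[OF _ _ 1(3) \<gamma>] bn by (simp add: pl0 1 del: lact_simps)
      fix p' l' assume pl': "p' \<in> P" "l' \<in> L" and nz: "lookup (lact l' (mon p')) (Word ?t) \<noteq> 0"
      have bn': "based_normal p'" "based_normal (Vert v # l')" "letter_tgt G (last p') = v"
        and len': "length p' = m" "length l' = n" using P(2) L(2) pl' by auto
      have len_t': "length ?t = length p' + length l'" using len_t len' by simp
      show "p' = p \<and> l' = l"
      proof (cases rule: lookup_lact_top_cases[OF bn' len_t' nz])
        case 1
        then show ?thesis using redex[OF pl'] by simp
      next
        case (2 p1 l1 \<alpha>' \<gamma>' i' j')
        have "length p0 = length p1" using 2(1) len(1) len'(1) by (simp add: pl0)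
        note eq = append_eq_split2[OF 2(5) this]
        \<comment> \<open>The word \<open>?t\<close> no longer shows which edge was replaced; the
          mixed pair of \<open>p'\<close> and \<open>l\<close> is also a redex and recovers
          it.\<close>
        have "\<alpha>' = \<alpha>" using redex[OF pl'(1) pl(2)] by (simp add: 2(1) pl0 1)
        then show ?thesis using 2(1,2) eq by (simp add: pl0 1)
      next
        case (3 p1 l1 \<alpha>' \<beta> k)
        have "length p0 = length p1" using 3(1) len(1) len'(1) by (simp add: pl0)
        note eq = append_eq_split2[OF 3(4) this]
        from eq show ?thesis by simp
      qed
    qed
  next
    case (2 \<alpha> \<beta>)
    \<comment> \<open>Index 2 is available because all weights are at least 2. The original index
      was 1, so nothing is lost by the replacement.\<close>
    let ?t = "p0 @ [Ghost \<alpha> 2, Edge \<beta> 2] @ l0"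
    have \<alpha>\<beta>: "\<alpha> \<in> sedges G" "\<beta> \<in> sedges G"
      using based_normal_alphabet[OF bn(1)] based_normal_alphabet[OF bn(2)] by (auto simp: pl0 2)
    have src: "src G \<beta> = src G \<alpha>" using bn by (auto simp: pl0 2 based_normal_def linked_def)
    show ?thesis
    proof (rule that[OF pl, of ?t]; (intro ballI impI)?)
      show len_t: "length ?t = m + n" using len by (simp add: pl0)
      show "lookup (lact l (mon p)) (Word ?t) \<in> {1, - 1}"
        using lookup_lact_ghost_edge[of p0 \<alpha> v \<beta> l0 2] bn src weight_ge_2[OF \<alpha>\<beta>(1)] weight_ge_2[OF \<alpha>\<beta>(2)]
        by (simp add: pl0 2 del: lact_simps)
      fix p' l' assume pl': "p' \<in> P" "l' \<in> L" and nz: "lookup (lact l' (mon p')) (Word ?t) \<noteq> 0"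
      have bn': "based_normal p'" "based_normal (Vert v # l')" "letter_tgt G (last p') = v"
        and len': "length p' = m" "length l' = n" using P(2) L(2) pl' by auto
      have len_t': "length ?t = length p' + length l'" using len_t len' by simp
      show "p' = p \<and> l' = l"
      proof (cases rule: lookup_lact_top_cases[OF bn' len_t' nz])
        case 1
        then show ?thesis using redex[OF pl'] by simp
      next
        case (2 p1 l1 \<alpha>' \<gamma>' i' j')
        have "length p0 = length p1" using 2(1) len(1) len'(1) by (simp add: pl0)
        note eq = append_eq_split2[OF 2(5) this]
        from eq show ?thesis by simp
      next
        case (3 p1 l1 \<alpha>' \<beta>' k)
        have "length p0 = length p1" using 3(1) len(1) len'(1) by (simp add: pl0)
        note eq = append_eq_split2[OF 3(4) this]
        from eq show ?thesis using 3(1,2) by (simp add: pl0 2)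
      qed
    qed
  qed
qed

end

section \<open>The valuation\<close>

lemma free_ring_mult:
  assumes "f \<in> free_ring G" "g \<in> free_ring G"
  shows "f * g \<in> free_ring G"
  using assms keys_mult[of f g] by (fastforce simp: free_ring_def plus_free_word_def)

lemma free_ring_add: "f \<in> free_ring G \<Longrightarrow> g \<in> free_ring G \<Longrightarrow> f + g \<in> free_ring G"
  using keys_add[of f g] by (auto simp: free_ring_def)

text \<open>The base vertex does not count towards the length of a path.\<close>

definition word_degree :: "('v, 'e) letter free_word \<Rightarrow> nat" where
  "word_degree w = length (letters w) - 1"

definition deg :: "('v, 'e, 'r::ring_1) free_elem \<Rightarrow> nat extended" where
  "deg m = (if m = 0 then -\<infinity> else Fin (Max (word_degree ` keys m)))"

lemma deg_add_le: "deg (f + g) \<le> max (deg f) (deg g)"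
proof (cases "f = 0 \<or> g = 0 \<or> f + g = 0")
  case True
  then show ?thesis by (auto simp: deg_def)
next
  case False
  have "Max (word_degree ` keys (f + g)) \<le> Max (word_degree ` (keys f \<union> keys g))"
    using False keys_add[of f g] by (intro Max_mono) auto
  also have "\<dots> = max (Max (word_degree ` keys f)) (Max (word_degree ` keys g))"
    using False by (simp add: image_Un Max_Un)
  finally have "Max (word_degree ` keys (f + g)) \<le> max (Max (word_degree ` keys f)) (Max (word_degree ` keys g))" .
  moreover have "max (Fin x) (Fin y) = Fin (max x y)" for x y :: nat by (simp add: max_def)
  ultimately show ?thesis using False by (simp only: deg_def if_False less_eq_extended.simps de_Morgan_disj)
qed

context weighted_graph_choice
begin

text \<open>The word is recovered from its stripped form by \<open>nf\<close>.\<close>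

lemma strip_base_inj:
  assumes "based_normal u" "based_normal w" "strip_base u = strip_base w"
  shows "u = w"
proof -
  have "single (Word u) (1::'r) = single (Word w) 1"
    using nf_strip_base[OF assms(1)] nf_strip_base[OF assms(2)] assms(3) by simp
  then have "keys (single (Word u) (1::'r)) = keys (single (Word w) (1::'r))" by (rule arg_cong)
  then show ?thesis by simp
qed

lemma path_length_strip_base:
  assumes "based_normal w"
  shows "path_length (strip_base w) = length w - 1"
  using assms
proof (cases w rule: strip_base.cases)
  case (1 v x l)
  then have "x \<in> edge_letters G" using assms based_normal_Cons_Cons(2) by blast
  then show ?thesis by (cases x; cases l) (simp_all add: 1)
next
  case ("2_2" b)
  then show ?thesis using assms by auto
qed simp

section \<open>Support, valuation and vanishing of a class in terms of \<open>nf\<close>\<close>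

lemma supp_class:
  assumes "f \<in> free_ring G"
  shows "supp G sp (lpa_class G f) = (\<lambda>w. strip_base (letters w)) ` keys (nf f)"
proof -
  have "inj_on strip_base (letters ` keys (nf f))"
    using keys_nf[OF assms] strip_base_inj by (intro inj_onI) blast
  from keys_lin_inj[OF this] show ?thesis
    by (simp add: supp_def NF_class[OF assms] strip_def image_image)
qed

lemma valuation_class:
  assumes "f \<in> free_ring G"
  shows "max_length_valuation G sp (lpa_class G f) = deg (nf f)"
proof -
  have "path_length ` supp G sp (lpa_class G f) = word_degree ` keys (nf f)"
    unfolding supp_class[OF assms] image_image word_degree_def
    using path_length_strip_base keys_nf[OF assms] by (intro image_cong) auto
  moreover have "supp G sp (lpa_class G f) = {} \<longleftrightarrow> nf f = 0"
    unfolding supp_class[OF assms] by simp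
  ultimately show ?thesis by (simp add: max_length_valuation_def deg_def)
qed

lemma class_eq_zero_iff:
  assumes "f \<in> free_ring G"
  shows "lpa_class G f = lpa_zero G \<longleftrightarrow> nf f = 0"
proof
  assume "lpa_class G f = lpa_zero G"
  then have "f - 0 \<in> lpa_ideal G" using lpa_class_eq_iff[OF assms] unfolding lpa_zero_def by blast
  then show "nf f = 0" using nf_ideal by simp
next
  assume "nf f = 0"
  then have "f - 0 \<in> lpa_ideal G" using cong_nf[OF assms] by (simp add: cong_ideal_def)
  then show "lpa_class G f = lpa_zero G" unfolding lpa_zero_def by (rule lpa_class_cong)
qed

lemma deg_nf_eq_0_iff:
  assumes "f \<in> free_ring G" "nf f \<noteq> 0"
  shows "deg (nf f) = Fin 0 \<longleftrightarrow> supp G sp (lpa_class G f) \<subseteq> {[Vert v] | v. v \<in> verts G}"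
proof -
  have "word_degree w = 0 \<longleftrightarrow> strip_base (letters w) \<in> {[Vert v] | v. v \<in> verts G}" if "w \<in> keys (nf f)" for w
  proof -
    have bn: "based_normal (letters w)" using keys_nf[OF assms(1) that] .
    then show ?thesis
    proof (cases "letters w" rule: strip_base.cases)
      case (1 v x l)
      then have "x \<in> edge_letters G" using bn based_normal_Cons_Cons(2) by metis
      then show ?thesis by (auto simp: 1 word_degree_def)
    qed (auto simp: word_degree_def)
  qed
  then have "supp G sp (lpa_class G f) \<subseteq> {[Vert v] | v. v \<in> verts G} \<longleftrightarrow> (\<forall>w\<in>keys (nf f). word_degree w = 0)"
    unfolding supp_class[OF assms(1)] by blast
  also have "\<dots> \<longleftrightarrow> Max (word_degree ` keys (nf f)) \<le> 0"
    using assms(2) by (subst Max_le_iff) auto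
  finally show ?thesis using assms(2) by (simp add: deg_def)
qed

lemma nf_free_ring: "f \<in> free_ring G \<Longrightarrow> nf f \<in> free_ring G"
  using keys_nf[of f] based_normal_alphabet by (fastforce simp: free_ring_def)

lemma class_nf: "f \<in> free_ring G \<Longrightarrow> lpa_class G (nf f) = lpa_class G f"
  using cong_sym[OF cong_nf, of f] by (intro lpa_class_cong) (simp add: cong_ideal_def)

lemma vertex_free_ring: "v \<in> verts G \<Longrightarrow> (vertex_elem v :: ('v, 'e, 'r) free_elem) \<in> free_ring G"
  by (auto simp: vertex_elem_def free_ring_def)

text \<open>The vertex \<open>v\<close> is the last letter to act, and every word it leaves ends at
  \<open>v\<close>.\<close>

lemma keys_nf_vertex_right:
  assumes "f \<in> free_ring G" "w \<in> keys (nf (f * vertex_elem v))"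
  shows "letter_tgt G (last (letters w)) = v"
proof -
  have "nf (f * vertex_elem v) = lin (\<lambda>u. lin (act (Vert v)) (lact u 1)) f"
    unfolding vertex_elem_def mult_word_lin nf_lin nf_word lact_append by simp
  then obtain u where "w \<in> keys (lin (act (Vert v)) (lact (letters u) 1))"
    using assms(2) keys_lin[of "\<lambda>u. lin (act (Vert v)) (lact u 1)" f] by auto
  then obtain t where t: "t \<in> keys (lact (letters u) 1)" "w \<in> keys (act (Vert v) (letters t))"
    using keys_lin[of "act (Vert v)"] by blast
  then have "letters t = [] \<or> based_normal (letters t)"
    using admissible_lact[OF admissible_one] by (auto simp: admissible_def)
  then show ?thesis using act_keys_admissible(2)[of "letters t" "letters w" "Vert v"] t by simp
qed

text \<open>The vertex \<open>v\<close> turns the empty word into the trivial path at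
  \<open>v\<close>, and later letters do not change the base.\<close>

lemma keys_nf_vertex_left:
  assumes "v \<in> verts G" "w \<in> keys (nf (vertex_elem v * f))"
  shows "hd (letters w) = Vert v"
proof -
  have "lin (act (Vert v)) 1 = mon [Vert v]"
    using act_Vert[of "[Vert v]" v] assms(1) by (simp add: one_eq_word act_Nil)
  then have "nf (vertex_elem v * f) = lin (\<lambda>u. lact u (mon [Vert v])) f"
    unfolding vertex_elem_def word_mult_lin nf_lin nf_word by simp
  then obtain u where u: "w \<in> keys (lact (letters u) (mon [Vert v]))"
    using assms(2) keys_lin[of "\<lambda>u. lact u (mon [Vert v])" f] by auto
  from lact_keys_bound[OF _ this, of 1 "Vert v"] assms(1) show ?thesis
    by (simp add: mon_def)
qed

end

context LV_graph_choice
begin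

text \<open>The length bound gives one inequality. For the other, the isolated word of top degree
  has as coefficient a product of two nonzero coefficients, up to sign.\<close>

lemma deg_nf_mult:
  assumes A: "\<And>u. u \<in> keys A \<Longrightarrow> based_normal (letters u) \<and> letter_tgt G (last (letters u)) = v"
    and B: "\<And>w. w \<in> keys B \<Longrightarrow> based_normal (letters w) \<and> hd (letters w) = Vert v"
    and ne: "A \<noteq> 0" "B \<noteq> 0"
  shows "deg (nf (A * B)) = deg A + deg B"
proof -
  define m where "m = Max (word_degree ` keys A)"
  define n where "n = Max (word_degree ` keys B)"
  have m: "word_degree u \<le> m" "length (letters u) = Suc (word_degree u)" if "u \<in> keys A" for u
    using that A[OF that] by (auto simp: m_def word_degree_def) (cases "letters u"; simp)
  have n: "word_degree w \<le> n" "letters w = Vert v # tl (letters w)" "length (tl (letters w)) = word_degree w" if "w \<in> keys B" for w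
    using that B[OF that] by (auto simp: n_def word_degree_def) (cases "letters w"; simp)
  have nf_AB: "nf (A * B) = (\<Sum>u\<in>keys A. \<Sum>w\<in>keys B.
      scale (lookup A u * lookup B w) (lact (tl (letters w)) (mon (letters u))))"
    using A B by (rule nf_mult)
  let ?C = "\<lambda>u w. lookup (lact (tl (letters w)) (mon (letters u)))"
  \<comment> \<open>The left words keep their base and have length \<open>Suc m\<close>; the right
    words lose it and have length \<open>n\<close>.\<close>
  let ?P = "letters ` {u \<in> keys A. word_degree u = m}" and ?L = "(\<lambda>w. tl (letters w)) ` {w \<in> keys B. word_degree w = n}"
  have "m \<in> word_degree ` keys A" "n \<in> word_degree ` keys B"
    unfolding m_def n_def using ne by (intro Max_in; simp)+
  then have P_ne: "?P \<noteq> {}" and L_ne: "?L \<noteq> {}" by auto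
  have P: "based_normal p \<and> letter_tgt G (last p) = v \<and> length p = Suc m" if "p \<in> ?P" for p
    using that A m by auto
  have L: "based_normal (Vert v # l) \<and> length l = n" if "l \<in> ?L" for l
    using that B n by auto
  from isolated_top_word[OF P_ne P L_ne L]
  obtain p l t where pl: "p \<in> ?P" "l \<in> ?L" "length t = Suc m + n" "lookup (lact l (mon p)) (Word t) \<in> {1, - 1}"
    and uniq: "\<forall>p'\<in>?P. \<forall>l'\<in>?L. lookup (lact l' (mon p')) (Word t) \<noteq> 0 \<longrightarrow> p' = p \<and> l' = l"
    .
  from pl(1,2) obtain u0 w0 where u0: "u0 \<in> keys A" "p = letters u0" and w0: "w0 \<in> keys B" "l = tl (letters w0)" by auto
  \<comment> \<open>Pairs of smaller total degree cannot reach the length of \<open>t\<close>, and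
    among the pairs of top degree \<open>t\<close> is isolated.\<close>
  have zero: "u = u0 \<and> w = w0" if u: "u \<in> keys A" and w: "w \<in> keys B" and nz: "?C u w (Word t) \<noteq> 0" for u w
  proof -
    have "\<not> length (letters u) + length (tl (letters w)) < length t"
      using nz lookup_lact_eq_0 A[OF u] by blast
    then have "word_degree u = m" "word_degree w = n" using m[OF u] n(1,3)[OF w] pl(3) by auto
    then have "letters u = p \<and> tl (letters w) = l" using u w nz by (intro uniq[rule_format]) auto
    then show ?thesis using u0 w0 n(2)[OF w] n(2)[OF w0(1)] by (metis free_word.expand)
  qed
  let ?c = "lookup A u0 * lookup B w0 * ?C u0 w0 (Word t)"
  have "lookup (nf (A * B)) (Word t) = (\<Sum>u\<in>keys A. \<Sum>w\<in>keys B. lookup A u * lookup B w * ?C u w (Word t))"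
    unfolding nf_AB lookup_sum lookup_scale ..
  also have "\<dots> = (\<Sum>u\<in>keys A. \<Sum>w\<in>keys B. if u = u0 then if w = w0 then ?c else 0 else 0)"
  proof (intro sum.cong refl)
    fix u w assume uw: "u \<in> keys A" "w \<in> keys B"
    show "lookup A u * lookup B w * ?C u w (Word t) = (if u = u0 then if w = w0 then ?c else 0 else 0)"
    proof (cases "u = u0 \<and> w = w0")
      case False
      then have "?C u w (Word t) = 0" using zero[OF uw] by blast
      then show ?thesis using False by simp
    qed simp
  qed
  also have "\<dots> = (\<Sum>u\<in>keys A. if u = u0 then ?c else 0)"
    using w0 by (intro sum.cong refl) auto
  also have "\<dots> = ?c" using u0 by simp
  \<comment> \<open>The absence of zero divisors in the coefficient ring enters here.\<close>
  also have "\<dots> \<noteq> 0"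
    using pl(4) u0 w0 by (auto simp: in_keys_iff)
  finally have t: "Word t \<in> keys (nf (A * B))" by (simp add: in_keys_iff)
  have "Max (word_degree ` keys (nf (A * B))) = m + n"
  proof (rule Max_eqI)
    show "m + n \<in> word_degree ` keys (nf (A * B))"
      using t pl(3) by (intro image_eqI[of _ _ "Word t"]) (auto simp: word_degree_def)
    fix d assume "d \<in> word_degree ` keys (nf (A * B))"
    then obtain x where x: "x \<in> keys (nf (A * B))" "d = word_degree x" by auto
    from subsetD[OF keys_sum x(1)[unfolded nf_AB]] obtain u where u: "u \<in> keys A"
      and x_u: "x \<in> keys (\<Sum>w\<in>keys B. scale (lookup A u * lookup B w) (lact (tl (letters w)) (mon (letters u))))"
      by (rule UN_E)
    from subsetD[OF keys_sum x_u] obtain w where w: "w \<in> keys B"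
      and x_w: "x \<in> keys (scale (lookup A u * lookup B w) (lact (tl (letters w)) (mon (letters u))))"
      by (rule UN_E)
    have "based_normal (letters x) \<and> length (letters x) \<le> length (letters u) + length (tl (letters w))
        \<and> hd (letters x) = hd (letters u)"
    proof (rule lact_keys_bound)
      show "x \<in> keys (lact (tl (letters w)) (mon (letters u)))" by (rule subsetD[OF keys_scale x_w])
      fix y assume "y \<in> keys (mon (letters u))"
      then have "y = u" using A[OF u] by (simp add: mon_based_normal)
      then show "based_normal (letters y) \<and> length (letters y) \<le> length (letters u) \<and> hd (letters y) = hd (letters u)"
        using A[OF u] by simp
    qed
    then show "d \<le> m + n" using m[OF u] n(1,3)[OF w] x(2) by (auto simp: word_degree_def[of x])
  qed simp
  moreover have "nf (A * B) \<noteq> 0" using t by auto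
  ultimately show ?thesis using ne by (simp add: deg_def m_def n_def)
qed

lemma local_valuation_max_length:
  "local_valuation G sp (max_length_valuation G sp :: ('v, 'e, 'r) lpa_elem \<Rightarrow> nat extended)"
  unfolding local_valuation_def
proof (intro conjI ballI)
  fix a :: "('v, 'e, 'r) lpa_elem" assume "a \<in> lpa G"
  then obtain f where f: "f \<in> free_ring G" "a = lpa_class G f" by (auto simp: lpa_def)
  note val = valuation_class[OF f(1)] class_eq_zero_iff[OF f(1)]
  show "max_length_valuation G sp a \<in> range Fin \<union> {-\<infinity>}"
    by (simp add: f(2) val deg_def)
  show "max_length_valuation G sp a = -\<infinity> \<longleftrightarrow> a = lpa_zero G"
    by (simp add: f(2) val deg_def)
  show "max_length_valuation G sp a = Fin 0 \<longleftrightarrow> a \<noteq> lpa_zero G \<and> supp G sp a \<subseteq> {[Vert v] | v. v \<in> verts G}"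
    using deg_nf_eq_0_iff[OF f(1)] by (cases "nf f = 0") (auto simp: f(2) val deg_def)
  fix b :: "('v, 'e, 'r) lpa_elem" assume "b \<in> lpa G"
  then obtain g where g: "g \<in> free_ring G" "b = lpa_class G g" by (auto simp: lpa_def)
  show "max_length_valuation G sp (lpa_add G a b) \<le> max (max_length_valuation G sp a) (max_length_valuation G sp b)"
    using deg_add_le[of "nf f" "nf g"] f g
    by (simp add: lpa_add_class valuation_class free_ring_add nf_add)
next
  fix v and a b :: "('v, 'e, 'r) lpa_elem"
  assume v: "v \<in> verts G"
    and "a \<in> {lpa_mult G x (lpa_vertex G v) | x. x \<in> lpa G}" "b \<in> {lpa_mult G (lpa_vertex G v) y | y. y \<in> lpa G}"
  then obtain f g where f: "f \<in> free_ring G" "a = lpa_mult G (lpa_class G f) (lpa_vertex G v)"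
    and g: "g \<in> free_ring G" "b = lpa_mult G (lpa_vertex G v) (lpa_class G g)" by (auto simp: lpa_def)
  \<comment> \<open>Normal forms put the factors into the shape required by
    \<open>deg_nf_mult\<close>: the words of \<open>A\<close> end at \<open>v\<close>, those of
    \<open>B\<close> are based at \<open>v\<close>.\<close>
  define A where "A = nf (f * vertex_elem v)"
  define B where "B = nf (vertex_elem v * g)"
  have fv: "f * vertex_elem v \<in> free_ring G" and vg: "vertex_elem v * g \<in> free_ring G"
    using f(1) g(1) vertex_free_ring[OF v] free_ring_mult by blast+
  have a: "a = lpa_class G A" and b: "b = lpa_class G B"
    using f g vertex_free_ring[OF v] by (simp_all add: lpa_vertex_def lpa_mult_class A_def B_def class_nf fv vg)
  have A_free: "A \<in> free_ring G" and B_free: "B \<in> free_ring G"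
    using nf_free_ring fv vg by (auto simp: A_def B_def)
  have val_a: "max_length_valuation G sp a = deg A" and val_b: "max_length_valuation G sp b = deg B"
    using f g vertex_free_ring[OF v]
    by (simp_all add: lpa_vertex_def lpa_mult_class valuation_class fv vg A_def B_def)
  have "max_length_valuation G sp (lpa_mult G a b) = deg (nf (A * B))"
    by (simp add: a b lpa_mult_class A_free B_free valuation_class free_ring_mult)
  also have "\<dots> = deg A + deg B"
  proof (cases "A = 0 \<or> B = 0")
    case True
    then show ?thesis by (auto simp: deg_def)
  next
    case False
    then show ?thesis
      using keys_nf[OF fv] keys_nf[OF vg] keys_nf_vertex_right[OF f(1), of _ v] keys_nf_vertex_left[OF v, of _ g]
      by (intro deg_nf_mult[of _ v]) (auto simp: A_def B_def)
  qed
  finally show "max_length_valuation G sp (lpa_mult G a b) = max_length_valuation G sp a + max_length_valuation G sp b"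
    by (simp add: val_a val_b)
qed

end

theorem proposition40:
  fixes G :: "('v, 'e) wgraph" and sp :: "'v \<Rightarrow> 'e"
  assumes "LV_graph G"
    and "special_choice G sp"
  shows "local_valuation G sp
    (max_length_valuation G sp :: ('v, 'e, 'r::ring_1_no_zero_divisors) lpa_elem \<Rightarrow> nat extended)"
proof -
  interpret LV_graph G by (rule assms(1))
  interpret LV_graph_choice G sp "TYPE('r)"
    by unfold_locales (rule assms(2))
  show ?thesis by (rule local_valuation_max_length)
qed

end
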